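(* Let $r,s,t\in\mathbb{R}$ satisfy $r,s>0$, $t>-1$ and $r+s-t>n+1$. Then $$\int_{\mathcal{U}}\frac{\rho(w)^t}{\rho(z,w)^r\,\rho(w,u)^s}\,dV(w)=\frac{C_1(n,r,s,t)}{\rho(z,u)^{r+s-t-n-1}}$$ holds for all $z,u\in\mathcal{U}$, where $$C_1(n,r,s,t)=\frac{4\pi^n\,\Gamma(1+t)\,\Gamma(r+s-t-n-1)}{\Gamma(r)\,\Gamma(s)}.$$
   Context: Fix a positive integer $n$. For $z,w\in\mathbb{C}^n$ write $\langle z,w\rangle=z_1\bar w_1+\cdots+z_n\bar w_n$ and $|z|=\sqrt{\langle z,z\rangle}$ (similarly on $\mathbb{C}^{n-1}$), and $z=(z',z_n)$ with $z'=(z_1,\dots,z_{n-1})\in\mathbb{C}^{n-1}$, $z_n\in\mathbb{C}$. The Siegel upper half-space is $\mathcal{U}=\{z\in\mathbb{C}^n:\operatorname{Im}z_n>|z'|^2\}$. For $z,w\in\mathcal{U}$ put $$\rho(z,w)=\tfrac{i}{2}(\bar w_n-z_n)-\langle z',w'\rangle,\qquad \rho(z)=\rho(z,z)=\operatorname{Im}z_n-|z'|^2 .$$ One has $\operatorname{Re}\rho(z,w)>0$ on $\mathcal{U}\times\mathcal{U}$, and real powers of $\rho(z,w)$ are taken with the principal branch. $dV$ is Lebesgue measure on $\mathbb{C}^n$. *)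

theory Defs
  imports "HOL-Analysis.Analysis"
begin

text \<open>
  Complex \<open>n\<close>-space is \<open>complex ^ 'n\<close> over a nonempty finite linearly ordered index type with
  \<open>CARD('n) = n\<close>. Its \<open>lborel\<close> is Lebesgue measure of the underlying real \<open>2n\<close>-space.
  The coordinate \<open>z\<^sub>n\<close> is the one at the greatest index; \<open>z'\<close> collects all the others
  (none of them if \<open>n = 1\<close>).
\<close>

definition last_idx :: "'n :: {finite, linorder}"
  where "last_idx = Max UNIV"

definition hinner' :: "complex ^ 'n :: {finite, linorder} \<Rightarrow> complex ^ 'n :: {finite, linorder} \<Rightarrow> complex"
  where "hinner' z w = (\<Sum>j\<in>UNIV - {last_idx}. z $ j * cnj (w $ j))"

definition norm' :: "complex ^ 'n :: {finite, linorder} \<Rightarrow> real"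
  where "norm' z = sqrt (\<Sum>j\<in>UNIV - {last_idx}. (cmod (z $ j))\<^sup>2)"

definition siegel :: "(complex ^ 'n :: {finite, linorder}) set"
  where "siegel = {z. Im (z $ last_idx) > (norm' z)\<^sup>2}"

definition rho :: "complex ^ 'n :: {finite, linorder} \<Rightarrow> complex ^ 'n :: {finite, linorder} \<Rightarrow> complex"
  where "rho z w = \<i> / 2 * (cnj (w $ last_idx) - z $ last_idx) - hinner' z w"

definition rho_diag :: "complex ^ 'n :: {finite, linorder} \<Rightarrow> real"
  where "rho_diag z = Im (z $ last_idx) - (norm' z)\<^sup>2"

definition C1 :: "nat \<Rightarrow> real \<Rightarrow> real \<Rightarrow> real \<Rightarrow> real"
  where "C1 n r s t =
    4 * pi ^ n * Gamma (1 + t) * Gamma (r + s - t - real n - 1) / (Gamma r * Gamma s)"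

lemma norm'_squared: "(norm' z)\<^sup>2 = (\<Sum>j\<in>UNIV - {last_idx}. (cmod (z $ j))\<^sup>2)"
  unfolding norm'_def by (intro real_sqrt_pow2 sum_nonneg) auto

lemma hinner'_self: "hinner' z z = of_real ((norm' z)\<^sup>2)"
  unfolding norm'_squared hinner'_def by (simp add: complex_norm_square del: of_real_power)

lemma rho_self: "rho z z = of_real (rho_diag z)"
  unfolding rho_def rho_diag_def hinner'_self
  by (simp add: complex_eq_iff del: of_real_power)

lemma Re_rho_pos:
  assumes "z \<in> siegel" "w \<in> siegel"
  shows "Re (rho z w) > 0"
proof -
  have le: "2 * Re (a * cnj b) \<le> (cmod a)\<^sup>2 + (cmod b)\<^sup>2" for a b :: complex
    using zero_le_power2[of "Re a - Re b"] zero_le_power2[of "Im a - Im b"]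
    unfolding cmod_power2 by (simp add: power2_eq_square algebra_simps)
  have "2 * Re (hinner' z w) \<le> (norm' z)\<^sup>2 + (norm' w)\<^sup>2"
    unfolding norm'_squared hinner'_def Re_sum sum_distrib_left sum.distrib[symmetric]
    by (intro sum_mono le)
  moreover have "2 * Re (rho z w) = Im (z $ last_idx) + Im (w $ last_idx) - 2 * Re (hinner' z w)"
    unfolding rho_def by simp
  ultimately show ?thesis
    using assms unfolding siegel_def by simp
qed

end

theory Submission
  imports Defs "HOL-Probability.Probability" "HOL-Complex_Analysis.Complex_Analysis"
begin

text \<open>
  Write \<open>w = (w', x + i (\<bar>w'\<bar>\<^sup>2 + y))\<close>, a shear of Lebesgue measure with \<open>\<rho>(w) = y\<close>. Then
  \<open>\<rho>(z,w) = A + i x / 2\<close> and \<open>\<rho>(w,u) = B - i x / 2\<close>, so that the integral over \<open>x\<close> is Cauchy's beta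
  integral, a multiple of \<open>(A + B) powr (1 - r - s)\<close>, and \<open>A + B = y + E(w')\<close>. Integrating over \<open>y\<close>
  is a beta integral and leaves a power of \<open>E(w')\<close>; since \<open>E\<close> is quadratic in \<open>w'\<close>, a Laplace
  representation of that power turns the integral over \<open>w'\<close> into a product of Gaussians.
  Absolute convergence follows from \<open>a powr (-r) * b powr (-s) \<le> a powr (-r-s) + b powr (-r-s)\<close>,
  which reduces it to the same computation with \<open>z = u\<close>, where all integrands are positive.
\<close>

section \<open>Laplace and beta integrals with complex parameter\<close>

text \<open>Residues are awkward for Cauchy's integral, since both factors are real powers with
  branch cuts. The formula is instead moved through its parameters: at (1, 1) it is elementary by
  partial fractions, integration by parts raises a parameter by one, and writing a power as an
  average of higher powers comes down from integer to real parameters. The beta integral behind this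
  averaging is the one that later integrates out y. The closed forms with a complex parameter rest
  on the Laplace integral of a power, which is Euler's integral for a positive real parameter and
  extends to the right half-plane by the identity theorem. In \<open>C1\<close>, the factor 4 is the
  2 of Cauchy's 2 pi times another 2 from the scaling x / 2; one power of pi is Cauchy's, the other
  n - 1 come from the complex Gaussians.\<close>

lemma measurable_complex_powr [measurable]:
  assumes [measurable]: "f \<in> borel_measurable M"
  shows "(\<lambda>x. (f x :: complex) powr a) \<in> borel_measurable M"
proof -
  define C where "C = - (\<real>\<^sub>\<le>\<^sub>0 :: complex set)"
  have C[measurable]: "C \<in> sets borel"
    unfolding C_def by (intro borel_open open_Compl closed_nonpos_Reals_complex)
  have 1: "(\<lambda>z. if z \<in> C then z powr a else 0) \<in> borel_measurable borel"
    by (intro borel_measurable_continuous_on_if C continuous_on_const continuous_on_powr_complex)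
       (auto simp: C_def complex_nonpos_Reals_iff intro!: continuous_intros)
  \<comment> \<open>The power is glued from a continuous piece on the open set \<open>C\<close>, the
    value 0 at the origin, and an explicit formula on the cut, where the principal logarithm is ln
    |z| + i pi.\<close>
  have "z powr a = (if z \<in> C then (if z \<in> C then z powr a else 0)
      else if z = 0 then 0 else exp (a * (of_real (ln (cmod z)) + \<i> * pi)))" for z
  proof (cases "z \<in> C \<or> z = 0")
    case False
    then obtain x where x: "z = complex_of_real x" "x < 0"
      by (force simp: C_def nonpos_Reals_def order_le_less)
    then have "Ln z = of_real (ln (cmod z)) + \<i> * pi"
      using Ln_minus[of "of_real (-x)"] Ln_of_real[of "-x"] by simp
    then show ?thesis using False by (simp add: powr_def)
  qed auto
  then have "(\<lambda>z. z powr a) = (\<lambda>z. if z \<in> C then (if z \<in> C then z powr a else 0)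
      else if z = 0 then 0 else exp (a * (of_real (ln (cmod z)) + \<i> * pi)))" by blast
  also have "\<dots> \<in> borel_measurable borel"
    using 1 by measurable
  finally show ?thesis by measurable
qed

lemma laplace_powr_real:
  fixes q d :: real
  assumes q: "q > 0" and d: "d > 0"
  shows "has_bochner_integral lborel
    (\<lambda>l. indicator {0<..} l * (l powr (q - 1) * exp (- (l * d)))) (Gamma q * d powr (- q))"
proof (rule has_bochner_integral_nn_integral)
  have "ennreal (Gamma q) = (\<integral>\<^sup>+t. ennreal (indicator {0..} t * t powr (q - 1) / exp t) \<partial>lborel)"
    by (rule Gamma_conv_nn_integral_real[OF q])
  also have "\<dots> = ennreal \<bar>d\<bar> * (\<integral>\<^sup>+l. ennreal (indicator {0..} (0 + d * l) * (0 + d * l) powr (q - 1) / exp (0 + d * l)) \<partial>lborel)"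
    using d by (intro nn_integral_real_affine) auto
  \<comment> \<open>Passing from \<open>{0..}\<close> to \<open>{0<..}\<close> changes nothing even
    pointwise, because \<open>0 powr x\<close> is 0 for every x.\<close>
  also have "(\<integral>\<^sup>+l. ennreal (indicator {0..} (0 + d * l) * (0 + d * l) powr (q - 1) / exp (0 + d * l)) \<partial>lborel)
      = (\<integral>\<^sup>+l. ennreal (d powr (q - 1)) * ennreal (indicator {0<..} l * (l powr (q - 1) * exp (- (l * d)))) \<partial>lborel)"
    using d q by (intro nn_integral_cong)
      (auto simp: indicator_def powr_mult exp_minus field_simps zero_le_mult_iff zero_less_mult_iff ennreal_mult' [symmetric])
  also have "\<dots> = ennreal (d powr (q - 1)) * (\<integral>\<^sup>+l. ennreal (indicator {0<..} l * (l powr (q - 1) * exp (- (l * d)))) \<partial>lborel)"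
    by (rule nn_integral_cmult) auto
  finally have *: "ennreal (Gamma q) = ennreal (d powr q) * (\<integral>\<^sup>+l. ennreal (indicator {0<..} l * (l powr (q - 1) * exp (- (l * d)))) \<partial>lborel)"
    using d by (simp add: mult.assoc[symmetric] ennreal_mult'[symmetric] powr_mult_base)
  have "ennreal (Gamma q * d powr (- q)) = ennreal (d powr (-q)) * ennreal (Gamma q)"
    by (simp add: ennreal_mult'' mult.commute)
  also have "\<dots> = (ennreal (d powr (-q)) * ennreal (d powr q)) * (\<integral>\<^sup>+l. ennreal (indicator {0<..} l * (l powr (q - 1) * exp (- (l * d)))) \<partial>lborel)"
    by (subst *) (simp add: mult.assoc)
  also have "ennreal (d powr (-q)) * ennreal (d powr q) = 1"
    using d by (simp add: ennreal_mult'[symmetric] powr_minus)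
  finally show "(\<integral>\<^sup>+l. ennreal (indicator {0<..} l * (l powr (q - 1) * exp (- (l * d)))) \<partial>lborel) = ennreal (Gamma q * d powr (- q))"
    by simp
qed (use q in \<open>auto intro!: Gamma_real_nonneg\<close>)

lemma laplace_powr_integrable:
  fixes q :: real
  assumes q: "q > 0" and D: "Re D > 0"
  shows "integrable lborel (\<lambda>l. indicator {0<..} l *\<^sub>R (of_real (l powr (q - 1)) * exp (- (of_real l * D))))"
proof -
  have "integrable lborel (\<lambda>l. indicator {0<..} l * (l powr (q - 1) * exp (- (l * Re D))))"
    using laplace_powr_real[OF assms] by (simp add: has_bochner_integral_iff)
  then show ?thesis
    by (rule Bochner_Integration.integrable_bound) (auto simp: norm_mult indicator_def)
qed

text \<open>Supplies the quadratic error term for differentiating the Laplace integral in its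
  parameter.\<close>

lemma exp_taylor1_bound: "cmod (exp w - 1 - w) \<le> (cmod w)\<^sup>2 * exp (cmod w)"
proof -
  have "cmod (exp w - (\<Sum>k\<le>1. w ^ k / fact k)) \<le> exp \<bar>Re w\<bar> * (cmod w ^ Suc 1) / fact 1"
    by (rule Taylor_exp)
  also have "\<dots> \<le> exp (cmod w) * (cmod w ^ Suc 1)"
    using abs_Re_le_cmod[of w] by (auto intro!: mult_right_mono)
  finally show ?thesis by (simp add: power2_eq_square algebra_simps)
qed

text \<open>Differentiation under the integral sign with an explicit error: the derivative brings
  down a factor -l, which raises q by one, and the second-order remainder is at most K
  |h|^2.\<close>

lemma laplace_powr_has_field_derivative:
  fixes q :: real
  assumes q: "q > 0" and D: "Re D > 0"
  defines "F \<equiv> \<lambda>q D. LINT l|lborel. indicator {0<..} l *\<^sub>R (of_real (l powr (q - 1)) * exp (- (of_real l * D)))"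
  shows "(F q has_field_derivative - F (q + 1) D) (at D)"
proof -
  \<comment> \<open>For |h| < d half of the decay survives: exp (l |h| - l Re D) is at most exp (- l
    d). The remainder is quadratic in l h, so it adds l^2 to the weight, whence q + 2 in
    \<open>K\<close>.\<close>
  define d where "d = Re D / 2"
  define K where "K = Gamma (q + 2) * d powr (- (q + 2))"
  have d: "d > 0" using D by (simp add: d_def)
  have K: "has_bochner_integral lborel (\<lambda>l. indicator {0<..} l * (l powr (q + 1) * exp (- (l * d)))) K"
    using laplace_powr_real[of "q + 2" d] q d by (simp add: K_def add.commute)
  have *: "norm (F q (D + h) - F q D - (- F (q + 1) D) * h) \<le> K * (norm h)\<^sup>2" if h: "norm h < d" for h
  proof -
    have Re: "Re (D + h) > 0"
      using h abs_Re_le_cmod[of h] D by (simp add: d_def)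
    note int = laplace_powr_integrable[OF q Re] laplace_powr_integrable[OF q D]
      laplace_powr_integrable[of "q + 1", OF _ D]
    let ?g = "\<lambda>l. indicator {0<..} l *\<^sub>R (of_real (l powr (q - 1)) * exp (- (of_real l * (D + h))))
       - indicator {0<..} l *\<^sub>R (of_real (l powr (q - 1)) * exp (- (of_real l * D)))
       - (- (indicator {0<..} l *\<^sub>R (of_real (l powr (q + 1 - 1)) * exp (- (of_real l * D))))) * h :: complex"
    have "has_bochner_integral lborel ?g (F q (D + h) - F q D - (- F (q + 1) D) * h)"
      unfolding F_def using q
      by (intro has_bochner_integral_diff has_bochner_integral_mult_left has_bochner_integral_minus
            has_bochner_integral_integrable int) auto
    then have g: "integrable lborel ?g" "F q (D + h) - F q D - (- F (q + 1) D) * h = (LINT l|lborel. ?g l)"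
      by (simp_all only: has_bochner_integral_iff)
    have "norm (LINT l|lborel. ?g l) \<le> (LINT l|lborel. (norm h)\<^sup>2 * (indicator {0<..} l * (l powr (q + 1) * exp (- (l * d)))))"
    proof (rule Bochner_Integration.integral_norm_bound_integral)
      show "integrable lborel ?g" by (rule g)
      show "integrable lborel (\<lambda>l. (norm h)\<^sup>2 * (indicator {0<..} l * (l powr (q + 1) * exp (- (l * d)))))"
        using K by (auto simp: has_bochner_integral_iff)
      fix l :: real
      show "norm (?g l) \<le> (norm h)\<^sup>2 * (indicator {0<..} l * (l powr (q + 1) * exp (- (l * d))))"
      proof (cases "l > 0")
        case True
        have lq: "l powr q = l * l powr (q - 1)" "l powr (q + 1) = l\<^sup>2 * l powr (q - 1)"
          using True powr_mult_base[of l "q - 1"] powr_mult_base[of l q]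
          by (simp_all add: power2_eq_square add.commute mult.assoc)
        \<comment> \<open>All three integrands share the factor l^(q-1) exp (- l D); what is left is
          the Taylor remainder of exp at - l h.\<close>
        have "?g l = of_real (l powr (q - 1)) * exp (- (of_real l * D)) * (exp (- (l * h)) - 1 - (- (l * h)))"
        proof -
          have "exp (- (of_real l * (D + h))) = exp (- (of_real l * D)) * exp (- (l * h))"
            by (simp add: exp_add[symmetric] algebra_simps)
          then show ?thesis using True by (simp add: lq algebra_simps power2_eq_square)
        qed
        then have "norm (?g l) \<le> l powr (q - 1) * exp (- (l * Re D)) * ((cmod (-(l * h)))\<^sup>2 * exp (cmod (-(l*h))))"
          using exp_taylor1_bound[of "-(l * h)"] by (simp add: norm_mult mult_left_mono)
        also have "\<dots> = (norm h)\<^sup>2 * l powr (q + 1) * exp (l * norm h - l * Re D)"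
        proof -
          have "exp (l * norm h - l * Re D) = exp (- (l * Re D)) * exp (l * norm h)"
            by (simp add: exp_add[symmetric])
          moreover have "cmod (- (l * h)) = l * norm h" using True by (simp add: norm_mult)
          ultimately show ?thesis unfolding lq(2) by (simp only: power_mult_distrib mult_ac)
        qed
        also have "\<dots> \<le> (norm h)\<^sup>2 * l powr (q + 1) * exp (- (l * d))"
        proof -
          have "l * norm h \<le> l * d" using True h by simp
          then have "l * norm h - l * Re D \<le> - (l * d)" by (simp add: d_def)
          then show ?thesis by (intro mult_left_mono) auto
        qed
        finally show ?thesis using True by (simp only: mult.assoc indicator_simps greaterThan_iff mult_1)
      next
        case False
        then have "indicator {0<..} l = (0::real)" by simp
        then show ?thesis by (simp only: scaleR_zero_left mult_zero_left mult_zero_right minus_zero diff_0_right norm_zero order_refl)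
      qed
    qed
    also have "\<dots> = K * (norm h)\<^sup>2"
      using K by (simp add: has_bochner_integral_iff)
    finally show ?thesis unfolding g(2) .
  qed
  have "((\<lambda>h. (F q (D + h) - F q D) / h) \<longlongrightarrow> - F (q + 1) D) (at 0)"
  proof (rule LIM_zero_cancel, rule Lim_transform_bound[where g = "\<lambda>h. of_real K * h"])
    show "\<forall>\<^sub>F h in at 0. norm ((F q (D + h) - F q D) / h - - F (q + 1) D) \<le> norm (of_real K * h)"
      unfolding eventually_at
    proof (intro exI[of _ d] conjI d ballI impI)
      fix h :: complex assume h: "h \<noteq> 0 \<and> dist h 0 < d"
      have "norm ((F q (D + h) - F q D) / h - - F (q + 1) D) = norm (F q (D + h) - F q D - (- F (q + 1) D) * h) / norm h"
        using h by (simp add: norm_divide[symmetric] field_simps)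
      also have "\<dots> \<le> K * (norm h)\<^sup>2 / norm h"
        using *[of h] h by (intro divide_right_mono) auto
      also have "\<dots> = K * norm h" using h by (simp add: power2_eq_square)
      also have "\<dots> \<le> norm (of_real K * h)" by (simp add: norm_mult mult_right_mono)
      finally show "norm ((F q (D + h) - F q D) / h - - F (q + 1) D) \<le> norm (of_real K * h)" .
    qed
    show "((\<lambda>h. complex_of_real K * h) \<longlongrightarrow> 0) (at 0)" by (auto intro!: tendsto_eq_intros)
  qed
  then show ?thesis by (simp add: DERIV_def)
qed

text \<open>Both sides are holomorphic in D on the right half-plane and agree on the positive reals,
  which accumulate at 1; the identity theorem does the rest.\<close>

lemma laplace_powr:
  fixes q :: real
  assumes q: "q > 0" and D: "Re D > 0"
  shows "has_bochner_integral lborel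
    (\<lambda>l. indicator {0<..} l *\<^sub>R (of_real (l powr (q - 1)) * exp (- (of_real l * D))))
    (of_real (Gamma q) * D powr (- of_real q))"
proof -
  define F where "F D = (LINT l|lborel. indicator {0<..} l *\<^sub>R (of_real (l powr (q - 1)) * exp (- (of_real l * D))))" for D :: complex
  let ?S = "{D. Re D > 0}"
  have "F holomorphic_on ?S"
    unfolding holomorphic_on_def field_differentiable_def F_def
    using laplace_powr_has_field_derivative[OF q] by (blast intro: has_field_derivative_at_within)
  moreover have "(\<lambda>D. of_real (Gamma q) * D powr (- of_real q)) holomorphic_on ?S"
    by (intro holomorphic_intros) (auto simp: complex_nonpos_Reals_iff)
  ultimately have hol: "(\<lambda>D. F D - of_real (Gamma q) * D powr (- of_real q)) holomorphic_on ?S"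
    by (rule holomorphic_on_diff)
  have "F D - of_real (Gamma q) * D powr (- of_real q) = 0"
  proof (rule analytic_continuation[OF hol])
    show "open ?S" by (rule open_halfspace_Re_gt)
    show "connected ?S" by (rule convex_connected[OF convex_halfspace_Re_gt])
    show "of_real ` {0<..} \<subseteq> ?S" by auto
    show "1 \<in> ?S" by simp
    show "1 islimpt (complex_of_real ` {0<..})"
      unfolding islimpt_approachable
    proof (intro allI impI)
      fix e :: real assume "e > 0"
      then have "of_real (1 + e / 2) \<in> complex_of_real ` {0<..}" by (intro imageI) simp
      moreover have "complex_of_real (1 + e / 2) \<noteq> 1" "dist (complex_of_real (1 + e / 2)) 1 < e"
        using \<open>e > 0\<close> by (simp_all add: dist_norm norm_divide)
      ultimately show "\<exists>x'\<in>complex_of_real ` {0<..}. x' \<noteq> 1 \<and> dist x' 1 < e" by blast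
    qed
    fix z assume "z \<in> complex_of_real ` {0<..}"
    then obtain d where d: "d > 0" "z = of_real d" by auto
    have "has_bochner_integral lborel (\<lambda>l. complex_of_real (indicator {0<..} l * (l powr (q - 1) * exp (- (l * d)))))
      (of_real (Gamma q * d powr (- q)))"
      using laplace_powr_real[OF q d(1)] by (rule has_bochner_integral_of_real)
    then have "F z = of_real (Gamma q * d powr (- q))"
      unfolding F_def d by (simp add: has_bochner_integral_iff scaleR_conv_of_real exp_of_real[symmetric])
    also have "\<dots> = of_real (Gamma q) * z powr (- of_real q)"
      using d powr_of_real[of d "-q"] by simp
    finally show "F z - of_real (Gamma q) * z powr (- of_real q) = 0" by simp
  qed (use D in auto)
  then show ?thesis
    using laplace_powr_integrable[OF assms] by (simp add: has_bochner_integral_iff F_def)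
qed

section \<open>Fubini with known inner integrals, and the beta integral with a complex shift\<close>

lemma (in pair_sigma_finite) integrable_pair_boundI:
  fixes f :: "_ \<Rightarrow> _ \<Rightarrow> _::{banach, second_countable_topology}"
  assumes [measurable]: "case_prod f \<in> borel_measurable (M1 \<Otimes>\<^sub>M M2)"
    and le: "\<And>x. x \<in> space M1 \<Longrightarrow> (\<integral>\<^sup>+y. norm (f x y) \<partial>M2) \<le> ennreal (N x)"
    and N: "integrable M1 N"
  shows "integrable (M1 \<Otimes>\<^sub>M M2) (case_prod f)"
proof (rule integrableI_bounded)
  have "(\<integral>\<^sup>+z. norm (case_prod f z) \<partial>(M1 \<Otimes>\<^sub>M M2)) = (\<integral>\<^sup>+x. \<integral>\<^sup>+y. norm (f x y) \<partial>M2 \<partial>M1)"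
    by (simp add: M2.nn_integral_fst[symmetric])
  also have "\<dots> \<le> (\<integral>\<^sup>+x. ennreal (N x) \<partial>M1)"
    by (intro nn_integral_mono le)
  also have "\<dots> \<le> (\<integral>\<^sup>+x. ennreal (norm (N x)) \<partial>M1)"
    by (intro nn_integral_mono ennreal_leI) simp
  also have "\<dots> < \<infinity>"
    using N by (simp add: integrable_iff_bounded)
  finally show "(\<integral>\<^sup>+z. norm (case_prod f z) \<partial>(M1 \<Otimes>\<^sub>M M2)) < \<infinity>" .
qed simp

text \<open>Evaluates an integral by changing order: \<open>h\<close> is the function whose integral
  is sought, represented as an inner integral, and \<open>g\<close> is the intermediate result in
  the other order, where the outer integral is known.\<close>

lemma (in pair_sigma_finite) has_bochner_integral_swap:
  fixes f :: "_ \<Rightarrow> _ \<Rightarrow> _::{banach, second_countable_topology}"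
  assumes int: "integrable (M1 \<Otimes>\<^sub>M M2) (case_prod f)"
    and h: "\<And>x. x \<in> space M1 \<Longrightarrow> has_bochner_integral M2 (f x) (h x)"
    and g: "\<And>y. y \<in> space M2 \<Longrightarrow> has_bochner_integral M1 (\<lambda>x. f x y) (g y)"
    and v: "has_bochner_integral M2 g v"
  shows "has_bochner_integral M1 h v"
proof -
  have h': "(\<integral>y. f x y \<partial>M2) = h x" if "x \<in> space M1" for x
    using h[OF that] by (simp add: has_bochner_integral_iff)
  have "integrable M1 (\<lambda>x. \<integral>y. f x y \<partial>M2)"
    using int by (rule integrable_fst)
  then have 1: "integrable M1 h"
    by (simp add: h' cong: Bochner_Integration.integrable_cong)
  have "integral\<^sup>L M1 h = (\<integral>x. (\<integral>y. f x y \<partial>M2) \<partial>M1)"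
    by (intro Bochner_Integration.integral_cong refl) (simp add: h')
  also have "\<dots> = (\<integral>y. (\<integral>x. f x y \<partial>M1) \<partial>M2)"
    by (rule Fubini_integral[OF int, symmetric])
  also have "\<dots> = integral\<^sup>L M2 g"
    using g by (intro Bochner_Integration.integral_cong refl) (auto simp: has_bochner_integral_iff)
  also have "\<dots> = v" using v by (simp add: has_bochner_integral_iff)
  finally show ?thesis using 1 by (simp add: has_bochner_integral_iff)
qed

lemma has_bochner_integral_cmult_cancel:
  fixes c :: "'a::{real_normed_field, second_countable_topology}"
  assumes "has_bochner_integral M (\<lambda>x. c * f x) v" and "c \<noteq> 0"
  shows "has_bochner_integral M f (v / c)"
  using has_bochner_integral_mult_right[OF assms(1), of "1 / c"] assms(2) by simp

text \<open>The kernel lies between two Laplace integrals: over l it produces the power -q of y + D,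
  over y a power of l times exp (- l D). Its modulus is the kernel at Re D, so absolute
  integrability is the same computation with a real parameter.\<close>

lemma beta_powr_kernel:
  fixes a q :: real
  assumes a: "0 < a" "a < q" and D: "Re D > 0"
  defines "f \<equiv> \<lambda>l y. indicator {0<..} l *\<^sub>R indicator {0<..} y *\<^sub>R
      (of_real (l powr (q - 1) * y powr (a - 1)) * exp (- (of_real l * (of_real y + D))))"
  shows "integrable (lborel \<Otimes>\<^sub>M lborel) (case_prod f)"
    and "l > 0 \<Longrightarrow> has_bochner_integral lborel (f l)
      (of_real (Gamma a) * (of_real (l powr (q - a - 1)) * exp (- (of_real l * D))))"
proof -
  \<comment> \<open>Kept general in \<open>D'\<close> because it is used twice: at D for the value
    and at Re D for the norm.\<close>
  have gen: "has_bochner_integral lborel (\<lambda>y. indicator {0<..} l *\<^sub>R indicator {0<..} y *\<^sub>R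
      (of_real (l powr (q - 1) * y powr (a - 1)) * exp (- (of_real l * (of_real y + D')))))
      (of_real (Gamma a) * (of_real (l powr (q - a - 1)) * exp (- (of_real l * D'))))"
    if l: "l > 0" for l :: real and D' :: complex
  proof -
    have "has_bochner_integral lborel
      (\<lambda>y. (of_real (l powr (q - 1)) * exp (- (of_real l * D'))) *
         complex_of_real (indicator {0<..} y * (y powr (a - 1) * exp (- (y * l)))))
      ((of_real (l powr (q - 1)) * exp (- (of_real l * D'))) * of_real (Gamma a * l powr (- a)))"
      using laplace_powr_real[OF a(1) l]
      by (intro has_bochner_integral_mult_right has_bochner_integral_of_real)
    moreover have "l powr (q - a - 1) = l powr (q - 1) * l powr (- a)"
      using l by (simp add: powr_add[symmetric] algebra_simps)
    moreover have "exp (- (of_real l * (of_real y + D'))) = exp (- (of_real l * D')) * complex_of_real (exp (- (y * l)))" for y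
      by (simp add: exp_add[symmetric] exp_of_real[symmetric] algebra_simps)
    ultimately show ?thesis
      using l by (simp add: scaleR_conv_of_real mult_ac)
  qed
  show "l > 0 \<Longrightarrow> has_bochner_integral lborel (f l)
      (of_real (Gamma a) * (of_real (l powr (q - a - 1)) * exp (- (of_real l * D))))"
    using gen[of l D] by (simp add: f_def)
  let ?N = "\<lambda>l. Gamma a * (indicator {0<..} l * (l powr (q - a - 1) * exp (- (l * Re D))))"
  show "integrable (lborel \<Otimes>\<^sub>M lborel) (case_prod f)"
  proof (rule lborel_pair.integrable_pair_boundI)
    show "integrable lborel ?N"
      using laplace_powr_real[of "q - a" "Re D"] a D by (auto simp: has_bochner_integral_iff)
    show "case_prod f \<in> borel_measurable (lborel \<Otimes>\<^sub>M lborel)"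
      unfolding f_def by measurable
    fix l :: real
    show "(\<integral>\<^sup>+ y. ennreal (norm (f l y)) \<partial>lborel) \<le> ennreal (?N l)"
    proof (cases "l > 0")
      case True
      from gen[OF True, of "of_real (Re D)"]
      have *: "has_bochner_integral lborel (\<lambda>y. Re (indicator {0<..} l *\<^sub>R indicator {0<..} y *\<^sub>R
          (of_real (l powr (q - 1) * y powr (a - 1)) * exp (- (of_real l * (of_real y + of_real (Re D)))))))
        (Re (of_real (Gamma a) * (of_real (l powr (q - a - 1)) * exp (- (of_real l * of_real (Re D))))))"
        by (rule has_bochner_integral_bounded_linear[OF bounded_linear_Re])
      have "norm (f l y) = Re (indicator {0<..} l *\<^sub>R indicator {0<..} y *\<^sub>R
          (of_real (l powr (q - 1) * y powr (a - 1)) * exp (- (of_real l * (of_real y + of_real (Re D))))))" for y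
        by (simp add: f_def norm_mult indicator_def Re_exp)
      then have "(\<integral>\<^sup>+ y. ennreal (norm (f l y)) \<partial>lborel) = ennreal (Re (of_real (Gamma a) * (of_real (l powr (q - a - 1)) * exp (- (of_real l * of_real (Re D))))))"
        using * by (metis (no_types, lifting) ext has_bochner_integral_iff nn_integral_eq_integral AE_I2 norm_ge_zero)
      then show ?thesis using True by (simp add: Re_exp)
    qed (simp add: f_def)
  qed
qed

text \<open>Integrating the kernel over l first gives Gamma q times the integrand; integrating over
  y first leaves a Laplace integral with exponent q - a. Comparing the two orders produces the
  quotient of Gammas.\<close>

lemma beta_powr:
  fixes a q :: real
  assumes a: "0 < a" "a < q" and D: "Re D > 0"
  shows "has_bochner_integral lborel
    (\<lambda>y. indicator {0<..} y *\<^sub>R (of_real (y powr (a - 1)) * (of_real y + D) powr (- of_real q)))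
    (of_real (Gamma a * Gamma (q - a) / Gamma q) * D powr of_real (a - q))"
proof -
  let ?f = "\<lambda>l y. indicator {0<..} l *\<^sub>R indicator {0<..} y *\<^sub>R
      (of_real (l powr (q - 1) * y powr (a - 1)) * exp (- (of_real l * (of_real y + D))))"
  have "has_bochner_integral lborel (\<lambda>y. of_real (Gamma q) *
     (indicator {0<..} y *\<^sub>R (of_real (y powr (a - 1)) * (of_real y + D) powr (- of_real q))))
     (of_real (Gamma a) * (of_real (Gamma (q - a)) * D powr (- of_real (q - a))))"
  proof (rule lborel_pair.has_bochner_integral_swap)
    show "integrable (lborel \<Otimes>\<^sub>M lborel) (\<lambda>(y, l). ?f l y)"
      using beta_powr_kernel(1)[OF assms] lborel_pair.integrable_product_swap_iff[of "\<lambda>(l, y). ?f l y"] by (simp add: split_def)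
    show "has_bochner_integral lborel (\<lambda>y. ?f l y) (of_real (Gamma a) *
      (indicator {0<..} l *\<^sub>R (of_real (l powr (q - a - 1)) * exp (- (of_real l * D)))))" for l
      using beta_powr_kernel(2)[OF assms, of l] by (cases "l > 0") auto
    show "has_bochner_integral lborel (\<lambda>l. of_real (Gamma a) *
      (indicator {0<..} l *\<^sub>R (of_real (l powr (q - a - 1)) * exp (- (of_real l * D)))))
      (of_real (Gamma a) * (of_real (Gamma (q - a)) * D powr (- of_real (q - a))))"
      using laplace_powr[of "q - a" D] a D by (intro has_bochner_integral_mult_right) auto
    show "has_bochner_integral lborel (\<lambda>l. ?f l y) (of_real (Gamma q) *
     (indicator {0<..} y *\<^sub>R (of_real (y powr (a - 1)) * (of_real y + D) powr (- of_real q))))" for y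
    proof (cases "y > 0")
      case True
      have "has_bochner_integral lborel (\<lambda>l. of_real (y powr (a - 1)) *
          (indicator {0<..} l *\<^sub>R (of_real (l powr (q - 1)) * exp (- (of_real l * (of_real y + D))))))
        (of_real (y powr (a - 1)) * (of_real (Gamma q) * (of_real y + D) powr (- of_real q)))"
        using laplace_powr[of q "of_real y + D"] a D True by (intro has_bochner_integral_mult_right) auto
      then show ?thesis using True by (simp add: scaleR_conv_of_real mult_ac)
    qed (simp add: has_bochner_integral_zero)
  qed
  moreover have "complex_of_real (Gamma q) \<noteq> 0" 
  proof -
    have "q > 0" using a by simp
    then have "Gamma q > 0" by (rule Gamma_real_pos)
    then show ?thesis unfolding of_real_eq_0_iff by linarith
  qed
  ultimately have "has_bochner_integral lborel
    (\<lambda>y. indicator {0<..} y *\<^sub>R (of_real (y powr (a - 1)) * (of_real y + D) powr (- of_real q)))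
    (of_real (Gamma a) * (of_real (Gamma (q - a)) * D powr (- of_real (q - a))) / of_real (Gamma q))"
    by (rule has_bochner_integral_cmult_cancel)
  then show ?thesis by (simp add: mult.assoc)
qed

text \<open>The form needed for positive majorants, obtained as the real part of the complex
  formula.\<close>

lemma beta_powr_real:
  fixes a q d :: real
  assumes a: "0 < a" "a < q" and d: "d > 0"
  shows "has_bochner_integral lborel
    (\<lambda>y. indicator {0<..} y * (y powr (a - 1) * (y + d) powr (- q)))
    (Gamma a * Gamma (q - a) / Gamma q * d powr (a - q))"
proof -
  have pw: "complex_of_real x powr of_real p = of_real (x powr p)" if "x > 0" for x p :: real
    using that powr_of_real[of x p] by simp
  from beta_powr[OF a, of "of_real d"] d
  have "has_bochner_integral lborel
    (\<lambda>y. Re (indicator {0<..} y *\<^sub>R (of_real (y powr (a - 1)) * (of_real y + of_real d) powr (- of_real q))))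
    (Re (of_real (Gamma a * Gamma (q - a) / Gamma q) * of_real d powr of_real (a - q)))"
    by (intro has_bochner_integral_bounded_linear[OF bounded_linear_Re]) auto
  moreover have "Re (indicator {0<..} y *\<^sub>R (of_real (y powr (a - 1)) * (of_real y + of_real d) powr (- of_real q)))
     = indicator {0<..} y * (y powr (a - 1) * (y + d) powr (- q))" for y
    using pw[of "y + d" "- q"] d by (auto simp: indicator_def)
  ultimately show ?thesis
    unfolding pw[OF d] by (simp only: of_real_mult[symmetric] Re_complex_of_real)
qed

section \<open>Cauchy's beta integral\<close>

lemma integral_FTC_UNIV:
  fixes f F :: "real \<Rightarrow> 'a::euclidean_space"
  assumes F: "\<And>x. (F has_vector_derivative f x) (at x)"
    and cont: "\<And>x. isCont f x" and int: "integrable lborel f"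
    and bot: "(F \<longlongrightarrow> a) at_bot" and top: "(F \<longlongrightarrow> b) at_top"
  shows "has_bochner_integral lborel f (b - a)"
proof -
  have "(LBINT x=-\<infinity>..\<infinity>. f x) = b - a"
    using assms by (intro interval_integral_FTC_integrable[where F = F])
      (auto simp: ereal_tendsto_simps set_integrable_def)
  then show ?thesis
    using int by (simp add: has_bochner_integral_iff interval_lebesgue_integral_def set_lebesgue_integral_def)
qed

section \<open>Moduli of powers along a vertical line\<close>

lemma cmod_powr_of_real: "cmod (z powr of_real a) = cmod z powr a"
  by (simp add: norm_powr_real_powr')

text \<open>Cutting at x = -c leaves two half-line beta integrals with first parameter 1, hence the
  factor 2.\<close>

lemma has_bochner_integral_abs_shift_powr:
  fixes a p :: real
  assumes a: "a > 0" and p: "p > 1"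
  shows "has_bochner_integral lborel (\<lambda>x. (a + \<bar>x + c\<bar>) powr (- p)) (2 * Gamma (p - 1) / Gamma p * a powr (1 - p))"
proof -
  let ?f = "\<lambda>y. indicator {0<..} y * (y + a) powr (- p)"
  let ?v = "Gamma (p - 1) / Gamma p * a powr (1 - p)"
  have "?f = (\<lambda>y. indicator {0<..} y * (y powr (1 - 1) * (y + a) powr (- p)))"
    by (auto simp: indicator_def)
  then have f: "has_bochner_integral lborel ?f ?v"
    using beta_powr_real[of 1 p a] a p by simp
  then have 1: "has_bochner_integral lborel (\<lambda>x. ?f (c + 1 * x)) ?v"
    using lborel_has_bochner_integral_real_affine_iff[of 1 ?f ?v c] by simp
  from f have 2: "has_bochner_integral lborel (\<lambda>x. ?f (- c + (-1) * x)) ?v"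
    using lborel_has_bochner_integral_real_affine_iff[of "-1" ?f ?v "-c"] by simp
  have "has_bochner_integral lborel (\<lambda>x. ?f (c + 1 * x) + ?f (- c + (-1) * x)) (?v + ?v)"
    by (rule has_bochner_integral_add[OF 1 2])
  then have "has_bochner_integral lborel (\<lambda>x. (a + \<bar>x + c\<bar>) powr (- p)) (?v + ?v)"
    \<comment> \<open>Both half-line indicators vanish at x = -c, so the functions agree only off
      this one point.\<close>
    by (rule has_bochner_integral_discrete_difference[where X = "{-c}", THEN iffD1, rotated 4])
       (auto simp: indicator_def algebra_simps)
  then show ?thesis by (simp add: mult.assoc)
qed

text \<open>A modulus dominates the real part and the absolute imaginary part, hence their mean, and
  powers of that mean have an explicit integral.\<close>

lemma cmod_halfplane_ge:
  assumes "Re A > 0"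
  shows "cmod (A + \<i> * of_real x) \<ge> (Re A + \<bar>x + Im A\<bar>) / 2"
proof -
  have "Re A \<le> cmod (A + \<i> * of_real x)" "\<bar>x + Im A\<bar> \<le> cmod (A + \<i> * of_real x)"
    using complex_Re_le_cmod[of "A + \<i> * of_real x"] abs_Im_le_cmod[of "A + \<i> * of_real x"]
    by (auto simp: add.commute)
  then show ?thesis by simp
qed

lemma cmod_halfplane_powr_le:
  assumes A: "Re A > 0" and p: "p \<ge> 0"
  shows "cmod (A + \<i> * of_real x) powr (- p) \<le> 2 powr p * (Re A + \<bar>x + Im A\<bar>) powr (- p)"
proof -
  have "cmod (A + \<i> * of_real x) powr (- p) \<le> ((Re A + \<bar>x + Im A\<bar>) / 2) powr (- p)"
    using cmod_halfplane_ge[OF A, of x] p A by (intro powr_mono2') auto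
  also have "\<dots> = 2 powr p * (Re A + \<bar>x + Im A\<bar>) powr (- p)"
    using A by (simp add: powr_divide powr_minus field_simps)
  finally show ?thesis .
qed

text \<open>The bound keeps its dependence on Re A, because in the Siegel coordinates Re A is a
  function of the remaining variables and this power is integrated over them next.\<close>

lemma cmod_halfplane_powr_integrable:
  assumes A: "Re A > 0" and p: "p > 1"
  shows "integrable lborel (\<lambda>x. cmod (A + \<i> * of_real x) powr (- p))"
    and "(LINT x|lborel. cmod (A + \<i> * of_real x) powr (- p))
      \<le> 2 powr p * (2 * Gamma (p - 1) / Gamma p) * Re A powr (1 - p)"
proof -
  have *: "has_bochner_integral lborel (\<lambda>x. 2 powr p * (Re A + \<bar>x + Im A\<bar>) powr (- p))
      (2 powr p * (2 * Gamma (p - 1) / Gamma p * Re A powr (1 - p)))"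
    by (intro has_bochner_integral_mult_right has_bochner_integral_abs_shift_powr A p)
  note le = cmod_halfplane_powr_le[OF A less_imp_le[OF less_trans[OF zero_less_one p]]]
  show 1: "integrable lborel (\<lambda>x. cmod (A + \<i> * of_real x) powr (- p))"
  proof (rule Bochner_Integration.integrable_bound[OF integrable.intros[OF *]], measurable, intro AE_I2)
    fix x
    show "norm (cmod (A + \<i> * of_real x) powr (- p)) \<le> norm (2 powr p * (Re A + \<bar>x + Im A\<bar>) powr (- p))"
      using le[of x] by (simp only: real_norm_def abs_of_nonneg[OF powr_ge_zero] order_trans[OF _ abs_ge_self])
  qed
  have "(LINT x|lborel. cmod (A + \<i> * of_real x) powr (- p))
     \<le> (LINT x|lborel. 2 powr p * (Re A + \<bar>x + Im A\<bar>) powr (- p))"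
    by (rule integral_mono[OF 1 integrable.intros[OF *] le])
  then show "(LINT x|lborel. cmod (A + \<i> * of_real x) powr (- p))
      \<le> 2 powr p * (2 * Gamma (p - 1) / Gamma p) * Re A powr (1 - p)"
    unfolding has_bochner_integral_integral_eq[OF *] by (simp only: mult.assoc)
qed

text \<open>The exponents are nonpositive, so replacing the larger base by the smaller one only
  increases the product; the sum covers both cases. This decouples the two factors of a
  kernel.\<close>

lemma powr_mult_le_powr_sum:
  fixes x y r s :: real
  assumes "x > 0" "y > 0" "r \<ge> 0" "s \<ge> 0"
  shows "x powr (- r) * y powr (- s) \<le> x powr (- (r + s)) + y powr (- (r + s))"
proof (cases "x \<le> y")
  case True
  then have "x powr (- r) * y powr (- s) \<le> x powr (- r) * x powr (- s)"
    using assms by (intro mult_left_mono powr_mono2') auto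
  also have "\<dots> = x powr (- (r + s))" by (simp only: minus_add_distrib powr_add)
  finally show ?thesis using powr_ge_zero[of y "- (r + s)"] by linarith
next
  case False
  then have "x powr (- r) * y powr (- s) \<le> y powr (- r) * y powr (- s)"
    using assms by (intro mult_right_mono powr_mono2') auto
  also have "\<dots> = y powr (- (r + s))" by (simp only: minus_add_distrib powr_add)
  finally show ?thesis using powr_ge_zero[of x "- (r + s)"] by linarith
qed

section \<open>The kernel of Cauchy's integral and passage between its parameters\<close>

definition cauchy_kernel :: "real \<Rightarrow> real \<Rightarrow> complex \<Rightarrow> complex \<Rightarrow> real \<Rightarrow> complex" where
  "cauchy_kernel r s A B x =
    (A + \<i> * of_real x) powr (- of_real r) * (B - \<i> * of_real x) powr (- of_real s)"

text \<open>Conjugation lets estimates for A + i x serve the factor with the opposite sign as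
  well.\<close>

lemma cmod_reflect: "cmod (B - \<i> * of_real x) = cmod (cnj B + \<i> * of_real x)"
proof -
  have "B - \<i> * of_real x = cnj (cnj B + \<i> * of_real x)" by (simp add: complex_eq_iff)
  then show ?thesis by (simp only: complex_mod_cnj)
qed

lemma cmod_cauchy_kernel:
  "cmod (cauchy_kernel r s A B x) =
    cmod (A + \<i> * of_real x) powr (- r) * cmod (cnj B + \<i> * of_real x) powr (- s)"
  unfolding cauchy_kernel_def norm_mult of_real_minus[symmetric] cmod_powr_of_real cmod_reflect ..

lemma cmod_cauchy_kernel_le:
  assumes "Re A > 0" "Re B > 0" "r \<ge> 0" "s \<ge> 0"
  shows "cmod (cauchy_kernel r s A B x) \<le>
    cmod (A + \<i> * of_real x) powr (- (r + s)) + cmod (cnj B + \<i> * of_real x) powr (- (r + s))"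
  unfolding cmod_cauchy_kernel
  using assms by (intro powr_mult_le_powr_sum) (auto simp: complex_eq_iff)

lemma cauchy_kernel_integrable:
  assumes "Re A > 0" "Re B > 0" "r \<ge> 0" "s \<ge> 0" "r + s > 1"
  shows "integrable lborel (cauchy_kernel r s A B)"
proof (rule Bochner_Integration.integrable_bound)
  show "integrable lborel (\<lambda>x. cmod (A + \<i> * of_real x) powr (- (r + s)) + cmod (cnj B + \<i> * of_real x) powr (- (r + s)))"
    by (rule Bochner_Integration.integrable_add[OF cmod_halfplane_powr_integrable(1)[OF assms(1,5)]
          cmod_halfplane_powr_integrable(1)[OF _ assms(5)]]) (simp add: assms(2))
  show "cauchy_kernel r s A B \<in> borel_measurable lborel"
    unfolding cauchy_kernel_def[abs_def] by measurable
  show "AE x in lborel. norm (cauchy_kernel r s A B x) \<le>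
      norm (cmod (A + \<i> * of_real x) powr (- (r + s)) + cmod (cnj B + \<i> * of_real x) powr (- (r + s)))"
    by (intro AE_I2 order_trans[OF cmod_cauchy_kernel_le[OF assms(1-4)]]) (simp only: real_norm_def abs_ge_self)
qed

text \<open>A predicate of the parameters with A and B quantified inside, because the passage from
  one parameter pair to another also moves these points: symmetry exchanges them and lowering shifts
  B.\<close>

definition cauchy_beta :: "real \<Rightarrow> real \<Rightarrow> bool" where
  "cauchy_beta r s \<longleftrightarrow> (\<forall>A B. Re A > 0 \<longrightarrow> Re B > 0 \<longrightarrow>
     has_bochner_integral lborel (cauchy_kernel r s A B)
       (of_real (2 * pi * Gamma (r + s - 1) / (Gamma r * Gamma s)) * (A + B) powr of_real (1 - r - s)))"

text \<open>The substitution of -x for x exchanges the two factors of the kernel.\<close>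

lemma cauchy_beta_commute:
  assumes "cauchy_beta r s"
  shows "cauchy_beta s r"
  unfolding cauchy_beta_def
proof (intro allI impI)
  fix A B :: complex assume "Re A > 0" "Re B > 0"
  then have "has_bochner_integral lborel (cauchy_kernel r s B A)
       (of_real (2 * pi * Gamma (r + s - 1) / (Gamma r * Gamma s)) * (B + A) powr of_real (1 - r - s))"
    using assms by (simp add: cauchy_beta_def)
  then have "has_bochner_integral lborel (\<lambda>x. cauchy_kernel r s B A (0 + (-1) * x))
       (of_real (2 * pi * Gamma (r + s - 1) / (Gamma r * Gamma s)) * (B + A) powr of_real (1 - r - s))"
    by (subst (asm) lborel_has_bochner_integral_real_affine_iff[of "-1" _ _ 0]) auto
  moreover have "1 - r - s = 1 - s - r" by simp
  ultimately show "has_bochner_integral lborel (cauchy_kernel s r A B)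
       (of_real (2 * pi * Gamma (s + r - 1) / (Gamma s * Gamma r)) * (A + B) powr of_real (1 - s - r))"
    by (simp add: cauchy_kernel_def[abs_def] mult.commute add.commute del: of_real_diff of_real_mult of_real_divide)
qed

text \<open>For x > 0 a factor x can be pulled out of both logarithms; the two terms ln x cancel,
  and Ln i - Ln (-i) remains in the limit.\<close>

lemma tendsto_Ln_halfplane_diff:
  assumes A: "Re A > 0" and B: "Re B > 0"
  shows "((\<lambda>x. Ln (A + \<i> * of_real x) - Ln (B - \<i> * of_real x)) \<longlongrightarrow> \<i> * pi) at_top"
proof -
  have lim: "((\<lambda>x. C / of_real x) \<longlongrightarrow> 0) at_top" for C :: complex
    by (rule tendsto_divide_0[OF tendsto_const filterlim_of_real_at_infinity])
  have lim': "((\<lambda>x. Ln (A / of_real x + \<i>) - Ln (B / of_real x - \<i>)) \<longlongrightarrow> Ln (0 + \<i>) - Ln (0 - \<i>)) at_top"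
    by (intro tendsto_intros lim) (auto simp: complex_nonpos_Reals_iff)
  have Ln_ii': "Ln (0 + \<i>) - Ln (0 - \<i>) = \<i> * pi" by simp
  have "\<forall>\<^sub>F x in at_top. Ln (A / of_real x + \<i>) - Ln (B / of_real x - \<i>) =
      Ln (A + \<i> * of_real x) - Ln (B - \<i> * of_real x)"
    using eventually_gt_at_top[of "0::real"]
  proof eventually_elim
    case (elim x)
    have "Ln (of_real x * (A / of_real x + \<i>)) = ln x + Ln (A / of_real x + \<i>)"
         "Ln (of_real x * (B / of_real x - \<i>)) = ln x + Ln (B / of_real x - \<i>)"
      using Ln_times_of_real[OF elim, of "A / of_real x + \<i>"] Ln_times_of_real[OF elim, of "B / of_real x - \<i>"]
        elim A B Ln_of_real[OF elim] by (simp_all add: complex_eq_iff[of _ 0])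
    then show ?case using elim by (simp add: algebra_simps)
  qed
  from Lim_transform_eventually[OF lim' this] show ?thesis unfolding Ln_ii' .
qed

text \<open>Partial fractions turn the kernel into 1 / (A + B) times the sum of 1 / (A + i x) and 1
  / (B - i x). Neither fraction is integrable alone, so the primitive keeps the two logarithms
  together as a difference, which grows by 2 pi i along the line.\<close>

lemma cauchy_beta_1_1: "cauchy_beta 1 1"
  unfolding cauchy_beta_def
proof (intro allI impI)
  fix A B :: complex assume A: "Re A > 0" and B: "Re B > 0"
  define G where "G x = (Ln (A + \<i> * of_real x) - Ln (B - \<i> * of_real x)) * (- \<i> / (A + B))" for x :: real
  have AB: "A + B \<noteq> 0" "A + \<i> * of_real x \<noteq> 0" "B - \<i> * of_real x \<noteq> 0" for x
    using A B by (auto simp: complex_eq_iff)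
  have eq: "cauchy_kernel 1 1 A B x = (\<i> / (A + \<i> * of_real x) + \<i> / (B - \<i> * of_real x)) * (- \<i> / (A + B))" for x
    using AB(1) AB(2,3)[of x] by (simp add: cauchy_kernel_def powr_minus divide_simps) (simp add: algebra_simps)
  have "has_bochner_integral lborel (cauchy_kernel 1 1 A B) (\<i> * pi * (- \<i> / (A + B)) - (- \<i> * pi * (- \<i> / (A + B))))"
  proof (rule integral_FTC_UNIV)
    show "integrable lborel (cauchy_kernel 1 1 A B)"
      using A B by (intro cauchy_kernel_integrable) auto
    show "(G \<longlongrightarrow> \<i> * pi * (- \<i> / (A + B))) at_top"
      unfolding G_def by (intro tendsto_intros tendsto_Ln_halfplane_diff A B)
    \<comment> \<open>The limit at minus infinity is the limit at plus infinity with A and B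
      exchanged and the sign reversed.\<close>
    have "((\<lambda>x. - (Ln (B + \<i> * of_real x) - Ln (A - \<i> * of_real x)) * (- \<i> / (A + B))) \<longlongrightarrow> - (\<i> * pi) * (- \<i> / (A + B))) at_top"
      by (intro tendsto_intros tendsto_Ln_halfplane_diff A B)
    then show "(G \<longlongrightarrow> - \<i> * pi * (- \<i> / (A + B))) at_bot"
      unfolding filterlim_at_bot_mirror G_def by simp
    show "isCont (cauchy_kernel 1 1 A B) x" for x
      unfolding cauchy_kernel_def using AB A B
      by (intro continuous_intros) (auto simp: complex_nonpos_Reals_iff)
    show "(G has_vector_derivative cauchy_kernel 1 1 A B x) (at x)" for x
    proof -
      have "((\<lambda>z. (Ln (A + \<i> * z) - Ln (B - \<i> * z)) * (- \<i> / (A + B))) has_field_derivative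
          (\<i> / (A + \<i> * of_real x) + \<i> / (B - \<i> * of_real x)) * (- \<i> / (A + B))) (at (of_real x))"
        using A B by (auto intro!: derivative_eq_intros simp: complex_nonpos_Reals_iff divide_inverse mult.commute)
      from has_vector_derivative_real_field[OF this] show ?thesis
        unfolding G_def eq .
    qed
  qed
  then have "has_bochner_integral lborel (cauchy_kernel 1 1 A B) (2 * of_real pi * inverse (A + B))"
    by (rule back_subst[of "has_bochner_integral lborel (cauchy_kernel 1 1 A B)"]) (simp add: divide_inverse)
  then show "has_bochner_integral lborel (cauchy_kernel 1 1 A B)
       (of_real (2 * pi * Gamma (1 + 1 - 1) / (Gamma 1 * Gamma 1)) * (A + B) powr of_real (1 - 1 - 1))"
    using AB(1) by (simp add: powr_minus)
qed

text \<open>The derivative of \<open>(A + i x) powr (-r) * (B - i x) powr (1 - s)\<close> is a combination of the kernels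
  with parameters \<open>(r + 1, s)\<close> and \<open>(r, s)\<close>, and its integral vanishes.\<close>

lemma cauchy_beta_raise:
  assumes cb: "cauchy_beta r s" and r: "r > 0" and s: "s \<ge> 1"
  shows "cauchy_beta (r + 1) s"
  unfolding cauchy_beta_def
proof (intro allI impI)
  fix A B :: complex assume A: "Re A > 0" and B: "Re B > 0"
  define G where "G x = (A + \<i> * of_real x) powr (- of_real r) * (B - \<i> * of_real x) powr (1 - of_real s)" for x :: real
  define c where "c = - \<i> * of_real r * (A + B)"
  define v where "v = of_real (2 * pi * Gamma (r + s - 1) / (Gamma r * Gamma s)) * (A + B) powr of_real (1 - r - s)"
  have AB: "A + B \<noteq> 0" "A + \<i> * of_real x \<noteq> 0" "B - \<i> * of_real x \<noteq> 0" for x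
    using A B by (auto simp: complex_eq_iff)
  have int: "has_bochner_integral lborel (cauchy_kernel r s A B) v"
    using cb A B unfolding cauchy_beta_def v_def by blast
  \<comment> \<open>Since s >= 1, the second factor of \<open>G\<close> stays below its bound at Re
    B, while r > 0 makes the first one decay; so both boundary terms vanish.\<close>
  have G_le: "norm (G x) \<le> 2 powr r * Re B powr (1 - s) * (Re A + \<bar>x + Im A\<bar>) powr (- r)" for x
  proof -
    have "norm (G x) = cmod (A + \<i> * of_real x) powr (- r) * cmod (B - \<i> * of_real x) powr (1 - s)"
      unfolding G_def norm_mult cmod_powr_of_real[symmetric] by simp
    also have "\<dots> \<le> (2 powr r * (Re A + \<bar>x + Im A\<bar>) powr (- r)) * Re B powr (1 - s)"
      using A B r s complex_Re_le_cmod[of "B - \<i> * of_real x"]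
      by (intro mult_mono cmod_halfplane_powr_le powr_mono2') auto
    finally show ?thesis by (simp only: mult_ac)
  qed
  have zero: "((\<lambda>x. 2 powr r * Re B powr (1 - s) * (Re A + \<bar>x + Im A\<bar>) powr (- r)) \<longlongrightarrow> 0) F"
    if "filterlim (\<lambda>x. Re A + \<bar>x + Im A\<bar>) at_top F" for F
    using that r by (intro tendsto_mult_right_zero tendsto_neg_powr) auto
  have top: "filterlim (\<lambda>x. Re A + \<bar>x + Im A\<bar>) at_top at_top"
    by (rule filterlim_at_top_mono[OF filterlim_tendsto_add_at_top[OF tendsto_const[of "Im A"] filterlim_ident]])
       (use A in \<open>auto intro!: always_eventually\<close>)
  have "filterlim (\<lambda>x. Re A + \<bar>- x + Im A\<bar>) at_top at_top"
    by (rule filterlim_at_top_mono[OF filterlim_tendsto_add_at_top[OF tendsto_const[of "- Im A"] filterlim_ident]])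
       (use A in \<open>auto intro!: always_eventually\<close>)
  then have bot: "filterlim (\<lambda>x. Re A + \<bar>x + Im A\<bar>) at_top at_bot"
    unfolding filterlim_at_bot_mirror .
  have "has_bochner_integral lborel (\<lambda>x. c * cauchy_kernel (r + 1) s A B x + \<i> * of_real (r + s - 1) * cauchy_kernel r s A B x) (0 - 0)"
  proof (rule integral_FTC_UNIV)
    show "integrable lborel (\<lambda>x. c * cauchy_kernel (r + 1) s A B x + \<i> * of_real (r + s - 1) * cauchy_kernel r s A B x)"
      using A B r s
      by (intro Bochner_Integration.integrable_add integrable_mult_right cauchy_kernel_integrable) auto
    show "(G \<longlongrightarrow> 0) at_top" "(G \<longlongrightarrow> 0) at_bot"
      using Lim_null_comparison[OF always_eventually zero[OF top]]
        Lim_null_comparison[OF always_eventually zero[OF bot]] G_le by blast+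
    show "isCont (\<lambda>x. c * cauchy_kernel (r + 1) s A B x + \<i> * of_real (r + s - 1) * cauchy_kernel r s A B x) x" for x
      unfolding cauchy_kernel_def using AB A B
      by (intro continuous_intros) (auto simp: complex_nonpos_Reals_iff)
    show "(G has_vector_derivative c * cauchy_kernel (r + 1) s A B x + \<i> * of_real (r + s - 1) * cauchy_kernel r s A B x) (at x)" for x
    proof -
      \<comment> \<open>With b = (A + B) - a, the term - i r a^(-r-1) b^(1-s) splits into a multiple
        of the (r + 1, s) kernel and i r times the (r, s) kernel; the other term of the product rule
        adds i (s - 1) times the latter.\<close>
      define a b where "a = A + \<i> * of_real x" and "b = B - \<i> * of_real x"
      have ab: "a \<noteq> 0" "b \<noteq> 0" "a + b = A + B" using AB by (auto simp: a_def b_def)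
      have pa: "a powr (- of_real r) = a * a powr (- of_real (r + 1))"
        using ab powr_add[of a "1" "- of_real (r + 1)"] by simp
      have pb: "b powr (1 - of_real s) = b * b powr (- of_real s)"
        using ab powr_add[of b "1" "- of_real s"] by simp
      have "((\<lambda>z. (A + \<i> * z) powr (- of_real r) * (B - \<i> * z) powr (1 - of_real s)) has_field_derivative
          (- of_real r * a powr (- of_real r - 1) * \<i>) * b powr (1 - of_real s)
           + ((1 - of_real s) * b powr (1 - of_real s - 1) * (- \<i>)) * a powr (- of_real r)) (at (of_real x))"
        unfolding a_def b_def
        using A B by (auto intro!: derivative_eq_intros simp: complex_nonpos_Reals_iff)
      also have "- of_real r - 1 = - complex_of_real (r + 1)" by simp
      also have "1 - of_real s - 1 = - complex_of_real s" by simp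
      also have "(- of_real r * a powr (- of_real (r + 1)) * \<i>) * b powr (1 - of_real s)
           + ((1 - of_real s) * b powr (- of_real s) * (- \<i>)) * a powr (- of_real r)
         = (- \<i> * of_real r * (a + b)) * (a powr (- of_real (r + 1)) * b powr (- of_real s))
          + \<i> * of_real (r + s - 1) * (a powr (- of_real r) * b powr (- of_real s))"
        unfolding pa pb by (simp add: algebra_simps)
      finally show ?thesis
        unfolding ab(3) using has_vector_derivative_real_field
        by (auto simp: G_def[abs_def] a_def b_def c_def cauchy_kernel_def)
    qed
  qed
  \<comment> \<open>Subtracting the known integral isolates the kernel with the raised
    parameter.\<close>
  then have "has_bochner_integral lborel (\<lambda>x. (c * cauchy_kernel (r + 1) s A B x + \<i> * of_real (r + s - 1) * cauchy_kernel r s A B x)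
       - \<i> * of_real (r + s - 1) * cauchy_kernel r s A B x) (0 - 0 - \<i> * of_real (r + s - 1) * v)"
    by (intro has_bochner_integral_diff has_bochner_integral_mult_right int)
  then have "has_bochner_integral lborel (\<lambda>x. c * cauchy_kernel (r + 1) s A B x) (- \<i> * of_real (r + s - 1) * v)"
    by simp
  then have "has_bochner_integral lborel (cauchy_kernel (r + 1) s A B) (- \<i> * of_real (r + s - 1) * v / c)"
    by (rule has_bochner_integral_cmult_cancel) (use AB r in \<open>auto simp: c_def\<close>)
  also have "- \<i> * of_real (r + s - 1) * v / c = of_real (r + s - 1) * v / (of_real r * (A + B))"
    using mult_divide_mult_cancel_left[of "- \<i>" "of_real (r + s - 1) * v" "of_real r * (A + B)"]
    by (simp add: c_def mult.assoc)
  \<comment> \<open>The functional equation of Gamma absorbs r + s - 1 and 1 / r, and 1 / (A + B)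
    lowers the exponent by one.\<close>
  also have "\<dots> = of_real (2 * pi * Gamma (r + 1 + s - 1) / (Gamma (r + 1) * Gamma s)) * (A + B) powr of_real (1 - (r + 1) - s)"
  proof -
    have e1: "(A + B) powr of_real (1 - r - s) = (A + B) * (A + B) powr of_real (1 - (r + 1) - s)"
    proof -
      have e: "of_real (1 - r - s) = 1 + complex_of_real (1 - (r + 1) - s)" by simp
      show ?thesis unfolding e powr_add using AB(1) by simp
    qed
    have e2: "Gamma (r + 1 + s - 1) = (r + s - 1) * Gamma (r + s - 1)"
      using Gamma_plus1[of "r + s - 1"] r s by (auto simp: nonpos_Ints_def)
    have e3: "Gamma (r + 1) = r * Gamma r"
      using Gamma_plus1[of r] r by (auto simp: nonpos_Ints_def)
    have e4: "of_real p * (of_real X * (w * W)) / (of_real r * w) = of_real (p * X / r) * W"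
      if "w \<noteq> 0" for p X :: real and w W :: complex using that by simp
    have e5: "p * (2 * pi * g / (a * b)) / r = 2 * pi * (p * g) / (r * a * b)" for p g a b
      by (simp only: times_divide_eq_right divide_divide_eq_left mult_ac)
    show ?thesis unfolding v_def e1 e2 e3 e4[OF AB(1)] e5 ..
  qed
  finally show "has_bochner_integral lborel (cauchy_kernel (r + 1) s A B)
    (of_real (2 * pi * Gamma (r + 1 + s - 1) / (Gamma (r + 1) * Gamma s)) * (A + B) powr of_real (1 - (r + 1) - s))" .
qed

text \<open>For \<open>s < q\<close> the power \<open>b powr (-s)\<close> is a mixture of the shifted powers \<open>(b + \<tau>) powr (-q)\<close>,
  and the shift preserves the half-plane of \<open>B\<close>.\<close>

lemma cauchy_beta_lower:
  assumes cb: "cauchy_beta r q" and r: "r > 0" and s: "0 < s" "s < q" and rs: "r + s > 1"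
  shows "cauchy_beta r s"
  unfolding cauchy_beta_def
proof (intro allI impI)
  fix A B :: complex assume A: "Re A > 0" and B: "Re B > 0"
  \<comment> \<open>\<open>k\<close> normalises the mixture: integrating the density
    \<open>w\<close> against (b + \<tau>)^(-q) gives k b^(-s). \<open>K\<close> is the constant
    already known for the parameters (r, q).\<close>
  define k where "k = Gamma (q - s) * Gamma s / Gamma q"
  define K where "K = 2 * pi * Gamma (r + q - 1) / (Gamma r * Gamma q)"
  define w where "w \<tau> = complex_of_real (indicator {0<..} \<tau> * \<tau> powr (q - s - 1))" for \<tau> :: real
  have G: "Gamma p \<noteq> 0" if "p > 0" for p :: real
    using Gamma_real_pos[OF that] by linarith
  have k: "k \<noteq> 0"
    using G[of "q - s"] G[of s] G[of q] s unfolding k_def by simp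
  let ?f = "\<lambda>x \<tau>. w \<tau> * cauchy_kernel r q A (B + of_real \<tau>) x"
  have B': "Re (B - \<i> * of_real x) > 0" for x using B by simp
  have beta_x: "has_bochner_integral lborel (?f x) (of_real k * cauchy_kernel r s A B x)" for x
  proof -
    have "has_bochner_integral lborel
       (\<lambda>\<tau>. (A + \<i> * of_real x) powr (- of_real r) *
         (indicator {0<..} \<tau> *\<^sub>R (of_real (\<tau> powr (q - s - 1)) * (of_real \<tau> + (B - \<i> * of_real x)) powr (- of_real q))))
       ((A + \<i> * of_real x) powr (- of_real r) *
         (of_real (Gamma (q - s) * Gamma (q - (q - s)) / Gamma q) * (B - \<i> * of_real x) powr of_real (q - s - q)))"
      using s by (intro has_bochner_integral_mult_right beta_powr B') auto
    moreover have "q - (q - s) = s" "complex_of_real (q - s - q) = - of_real s" by simp_all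
    moreover have "of_real \<tau> + (B - \<i> * of_real x) = B + of_real \<tau> - \<i> * of_real x" for \<tau> by simp
    ultimately show ?thesis
      by (simp only: w_def k_def cauchy_kernel_def scaleR_conv_of_real of_real_mult mult_ac)
  qed
  have "has_bochner_integral lborel (\<lambda>x. of_real k * cauchy_kernel r s A B x)
    (of_real (K * (Gamma (q - s) * Gamma (r + s - 1) / Gamma (r + q - 1))) * (A + B) powr of_real (1 - r - s))"
  proof (rule lborel_pair.has_bochner_integral_swap[OF _ beta_x])
    show "integrable (lborel \<Otimes>\<^sub>M lborel) (\<lambda>(x, \<tau>). ?f x \<tau>)"
    proof (rule lborel_pair.integrable_pair_boundI)
      show "(\<lambda>(x, \<tau>). ?f x \<tau>) \<in> borel_measurable (lborel \<Otimes>\<^sub>M lborel)"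
        unfolding w_def cauchy_kernel_def by measurable
      \<comment> \<open>After the integration over \<tau> the majorant is a multiple of the modulus
        of the (r, s) kernel, which is integrable because r + s > 1.\<close>
      show "integrable lborel (\<lambda>x. 2 powr q * k * cmod (cauchy_kernel r s A B x))"
        using A B r s rs by (intro integrable_mult_right integrable_norm cauchy_kernel_integrable) auto
      fix x
      define d where "d = cmod (B - \<i> * of_real x)"
      have d: "d > 0" using B'[of x] by (auto simp: d_def)
      define C where "C = 2 powr q * cmod (A + \<i> * of_real x) powr (- r)"
      have "(\<integral>\<^sup>+\<tau>. ennreal (norm (?f x \<tau>)) \<partial>lborel) \<le>
        (\<integral>\<^sup>+\<tau>. ennreal (C * (indicator {0<..} \<tau> * (\<tau> powr (q - s - 1) * (\<tau> + d) powr (- q)))) \<partial>lborel)"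
      proof (intro nn_integral_mono ennreal_leI)
        fix \<tau> :: real
        show "norm (?f x \<tau>) \<le> C * (indicator {0<..} \<tau> * (\<tau> powr (q - s - 1) * (\<tau> + d) powr (- q)))"
        proof (cases "\<tau> > 0")
          case True
          let ?b = "B + of_real \<tau> - \<i> * of_real x"
          \<comment> \<open>Moving a point of the half-plane to the right by \<tau> leaves its
            modulus at least \<tau> and at least the old modulus \<open>d\<close>, hence at least
            their mean. This trades the complex sum for a real one at the price of 2^q.\<close>
          have "\<tau> \<le> cmod ?b" using complex_Re_le_cmod[of ?b] B by simp
          moreover have "(cmod (B - \<i> * of_real x))\<^sup>2 \<le> (cmod ?b)\<^sup>2"
            unfolding cmod_power2 using True B by (auto intro!: power_mono)
          then have "d \<le> cmod ?b" unfolding d_def by (rule power2_le_imp_le) simp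
          ultimately have "(\<tau> + d) / 2 \<le> cmod ?b" by simp
          then have "cmod ?b powr (- q) \<le> ((\<tau> + d) / 2) powr (- q)"
            using True d s by (intro powr_mono2') auto
          also have "\<dots> = 2 powr q * (\<tau> + d) powr (- q)"
            using True d by (simp add: powr_divide powr_minus field_simps)
          finally have b: "cmod ?b powr (- q) \<le> 2 powr q * (\<tau> + d) powr (- q)" .
          have "norm (?f x \<tau>) = \<tau> powr (q - s - 1) * (cmod (A + \<i> * of_real x) powr (- r) * cmod ?b powr (- q))"
            using True unfolding cauchy_kernel_def norm_mult of_real_minus[symmetric] cmod_powr_of_real
            by (simp add: w_def)
          also have "\<dots> \<le> \<tau> powr (q - s - 1) * (cmod (A + \<i> * of_real x) powr (- r) * (2 powr q * (\<tau> + d) powr (- q)))"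
            by (intro mult_left_mono b) auto
          finally show ?thesis using True by (simp add: C_def mult_ac)
        qed (simp add: w_def)
      qed
      also have "\<dots> = ennreal (C * (Gamma (q - s) * Gamma (q - (q - s)) / Gamma q * d powr (q - s - q)))"
      proof -
        have *: "has_bochner_integral lborel (\<lambda>\<tau>. C * (indicator {0<..} \<tau> * (\<tau> powr (q - s - 1) * (\<tau> + d) powr (- q))))
            (C * (Gamma (q - s) * Gamma (q - (q - s)) / Gamma q * d powr (q - s - q)))"
          using s d by (intro has_bochner_integral_mult_right beta_powr_real) auto
        show ?thesis
          using nn_integral_eq_integral[OF integrable.intros[OF *]] has_bochner_integral_integral_eq[OF *]
          by (simp add: C_def)
      qed
      also have "C * (Gamma (q - s) * Gamma (q - (q - s)) / Gamma q * d powr (q - s - q))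
        = 2 powr q * k * cmod (cauchy_kernel r s A B x)"
        unfolding cmod_cauchy_kernel C_def k_def d_def cmod_reflect by simp
      finally show "(\<integral>\<^sup>+\<tau>. ennreal (norm (?f x \<tau>)) \<partial>lborel) \<le> ennreal (2 powr q * k * cmod (cauchy_kernel r s A B x))" .
    qed
    show "has_bochner_integral lborel (\<lambda>x. ?f x \<tau>)
      (of_real K * (indicator {0<..} \<tau> *\<^sub>R (of_real (\<tau> powr (q - s - 1)) * (of_real \<tau> + (A + B)) powr (- of_real (r + q - 1)))))" for \<tau>
    proof (cases "\<tau> > 0")
      case True
      have "has_bochner_integral lborel (cauchy_kernel r q A (B + of_real \<tau>)) (of_real K * (A + (B + of_real \<tau>)) powr of_real (1 - r - q))"
        using cb A B True unfolding cauchy_beta_def K_def by simp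
      then have "has_bochner_integral lborel (\<lambda>x. ?f x \<tau>) (w \<tau> * (of_real K * (A + (B + of_real \<tau>)) powr of_real (1 - r - q)))"
        by (rule has_bochner_integral_mult_right)
      moreover have "A + (B + of_real \<tau>) = of_real \<tau> + (A + B)" "of_real (1 - r - q) = - complex_of_real (r + q - 1)"
        by simp_all
      ultimately show ?thesis using True by (simp only: w_def) (simp add: mult_ac)
    qed (simp add: w_def has_bochner_integral_zero)
    \<comment> \<open>Convergence of the remaining beta integral at infinity is exactly r + s >
      1.\<close>
    have "q - s < r + q - 1" "0 < q - s" using s rs by simp_all
    from beta_powr[OF this(2,1), of "A + B"] A B
    have "has_bochner_integral lborel (\<lambda>\<tau>. of_real K * (indicator {0<..} \<tau> *\<^sub>R (of_real (\<tau> powr (q - s - 1)) * (of_real \<tau> + (A + B)) powr (- of_real (r + q - 1)))))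
      (of_real K * (of_real (Gamma (q - s) * Gamma (r + q - 1 - (q - s)) / Gamma (r + q - 1)) * (A + B) powr of_real (q - s - (r + q - 1))))"
      by (intro has_bochner_integral_mult_right) simp
    moreover have "r + q - 1 - (q - s) = r + s - 1" "q - s - (r + q - 1) = 1 - r - s" by simp_all
    ultimately show "has_bochner_integral lborel (\<lambda>\<tau>. of_real K * (indicator {0<..} \<tau> *\<^sub>R (of_real (\<tau> powr (q - s - 1)) * (of_real \<tau> + (A + B)) powr (- of_real (r + q - 1)))))
      (of_real (K * (Gamma (q - s) * Gamma (r + s - 1) / Gamma (r + q - 1))) * (A + B) powr of_real (1 - r - s))"
      by (simp only: of_real_mult mult.assoc)
  qed
  then have "has_bochner_integral lborel (cauchy_kernel r s A B)
    (of_real (K * (Gamma (q - s) * Gamma (r + s - 1) / Gamma (r + q - 1))) * (A + B) powr of_real (1 - r - s) / of_real k)"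
    by (rule has_bochner_integral_cmult_cancel) (use k in simp)
  moreover have "K * (Gamma (q - s) * Gamma (r + s - 1) / Gamma (r + q - 1)) / k = 2 * pi * Gamma (r + s - 1) / (Gamma r * Gamma s)"
  proof -
    have "Gamma (q - s) \<noteq> 0" "Gamma q \<noteq> 0" "Gamma (r + q - 1) \<noteq> 0"
      using s r rs by (intro G; simp)+
    then show ?thesis unfolding K_def k_def by simp
  qed
  ultimately show "has_bochner_integral lborel (cauchy_kernel r s A B)
    (of_real (2 * pi * Gamma (r + s - 1) / (Gamma r * Gamma s)) * (A + B) powr of_real (1 - r - s))"
    by (simp only: of_real_divide[symmetric] times_divide_eq_left[symmetric])
qed

text \<open>Raising from (1, 1), with symmetry to reach the second slot, gives all pairs of positive
  integers. Lowering from integers above s and r then reaches the real pair, one parameter at a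
  time, with symmetry in between.\<close>

theorem cauchy_beta_integral:
  assumes "r > 0" "s > 0" "r + s > 1"
  shows "cauchy_beta r s"
proof -
  have 1: "cauchy_beta (1 + real m) 1" for m
  proof (induction m)
    case (Suc m)
    then show ?case using cauchy_beta_raise[of "1 + real m" 1] by (simp add: add_ac)
  qed (simp add: cauchy_beta_1_1)
  have 2: "cauchy_beta (1 + real m) (1 + real k)" for m k
  proof (induction m)
    case 0
    show ?case using cauchy_beta_commute[OF 1[of k]] by simp
  next
    case (Suc m)
    then show ?case using cauchy_beta_raise[of "1 + real m" "1 + real k"] by (simp add: add_ac)
  qed
  obtain m where "r < real m" by (rule exE[OF reals_Archimedean2])
  then have m: "r < 1 + real m" by simp
  obtain k where "s < real k" by (rule exE[OF reals_Archimedean2])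
  then have k: "s < 1 + real k" by simp
  have "cauchy_beta (1 + real m) s"
    by (rule cauchy_beta_lower[OF 2[of m k] _ assms(2) k]) (use assms m in auto)
  from cauchy_beta_commute[OF this] have "cauchy_beta s r"
    by (rule cauchy_beta_lower) (use assms m in auto)
  then show ?thesis by (rule cauchy_beta_commute)
qed

section \<open>Complex Gaussian integrals\<close>

text \<open>Completing the square uses only Re c, so the shift is real and no contour is moved; the
  oscillation left by Im c is evaluated by the characteristic function of the standard normal
  distribution.\<close>

lemma gaussian_complex_linear:
  fixes l :: real and c :: complex
  assumes l: "l > 0"
  shows "has_bochner_integral lborel (\<lambda>x. exp (- of_real (l * x\<^sup>2) + of_real l * c * of_real x))
    (of_real (sqrt (pi / l)) * exp (of_real l * c\<^sup>2 / 4))"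
proof -
  \<comment> \<open>\<open>m\<close> is the centre of the Gaussian, and \<open>d\<close> the scale
    with l d^2 = 1/2, so that x = m + d y turns the weight into exp (- y^2 / 2); \<open>b\<close> is
    the frequency in y.\<close>
  define m where "m = Re c / 2"
  define d where "d = 1 / sqrt (2 * l)"
  define b where "b = l * Im c * d"
  have d: "d > 0" "l * d\<^sup>2 = 1 / 2" using l by (simp_all add: d_def power_divide)
  define K where "K = of_real (sqrt (2 * pi)) * exp (of_real (l * m\<^sup>2) + \<i> * of_real (l * Im c * m))"
  let ?f = "\<lambda>x. exp (- of_real (l * x\<^sup>2) + of_real l * c * of_real x)"
  have int: "integrable std_normal_distribution (\<lambda>x. iexp (b * x))"
  proof -
    interpret prob_space std_normal_distribution by (rule prob_space_normal_density) simp
    show ?thesis by (rule integrable_const_bound[of _ 1]) auto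
  qed
  have "has_bochner_integral std_normal_distribution (\<lambda>x. iexp (b * x)) (exp (- (b\<^sup>2) / 2))"
    using int fun_cong[OF char_std_normal_distribution, of b]
    by (simp add: has_bochner_integral_iff char_def)
  then have "has_bochner_integral lborel (\<lambda>y. std_normal_density y *\<^sub>R iexp (b * y)) (exp (- (b\<^sup>2) / 2))"
    using int by (simp add: has_bochner_integral_iff integrable_density integral_density)
  then have "has_bochner_integral lborel (\<lambda>y. K * (std_normal_density y *\<^sub>R iexp (b * y))) (K * exp (- (b\<^sup>2) / 2))"
    by (rule has_bochner_integral_mult_right)
  also have "(\<lambda>y. K * (std_normal_density y *\<^sub>R iexp (b * y))) = (\<lambda>y. ?f (m + d * y))"
  proof
    fix y :: real
    have e: "- of_real (l * (m + d * y)\<^sup>2) + of_real l * c * of_real (m + d * y) =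
       (of_real (l * m\<^sup>2) + \<i> * of_real (l * Im c * m)) + complex_of_real (- (y\<^sup>2) / 2) + \<i> * of_real (b * y)"
    proof -
      have "Re c = 2 * m" by (simp add: m_def)
      have "c = of_real (2 * m) + \<i> * of_real (Im c)" by (simp add: m_def complex_eq_iff)
      then have "of_real l * c * of_real (m + d * y) = of_real (l * (2 * m) * (m + d * y)) + \<i> * of_real (l * Im c * m + b * y)"
        by (simp add: b_def complex_eq_iff algebra_simps m_def)
      moreover have "l * (2 * m) * (m + d * y) - l * (m + d * y)\<^sup>2 = l * m\<^sup>2 - (l * d\<^sup>2) * y\<^sup>2"
        by (simp add: power2_eq_square algebra_simps)
      ultimately show ?thesis
        unfolding d(2) by (simp add: complex_eq_iff \<open>Re c = 2 * m\<close>)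
    qed
    have "K * (std_normal_density y *\<^sub>R iexp (b * y)) =
       exp (of_real (l * m\<^sup>2) + \<i> * of_real (l * Im c * m)) * of_real (exp (- (y\<^sup>2) / 2)) * iexp (b * y)"
      by (simp add: K_def std_normal_density_def scaleR_conv_of_real)
    also have "\<dots> = ?f (m + d * y)"
      unfolding e exp_add exp_of_real[symmetric] by simp
    finally show "K * (std_normal_density y *\<^sub>R iexp (b * y)) = ?f (m + d * y)" .
  qed
  finally have 1: "has_bochner_integral lborel (\<lambda>y. ?f (m + d * y)) (K * exp (- (b\<^sup>2) / 2))" by simp
  have "(K * exp (- (b\<^sup>2) / 2)) = (of_real (sqrt (pi / l)) * exp (of_real l * c\<^sup>2 / 4)) /\<^sub>R \<bar>d\<bar>"
  proof -
    have "b\<^sup>2 = (l * d\<^sup>2) * (l * (Im c)\<^sup>2)" by (simp add: b_def power2_eq_square)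
    then have b: "b\<^sup>2 = l * (Im c)\<^sup>2 / 2" unfolding d(2) by simp
    have "of_real l * c\<^sup>2 / 4 = (of_real (l * m\<^sup>2) + \<i> * of_real (l * Im c * m)) + of_real (- (b\<^sup>2) / 2)"
      unfolding b by (simp add: complex_eq_iff power2_eq_square m_def field_simps)
    then have "exp (of_real l * c\<^sup>2 / 4) = exp (of_real (l * m\<^sup>2) + \<i> * of_real (l * Im c * m)) * exp (- (b\<^sup>2) / 2)"
      unfolding exp_of_real[symmetric] by (simp only: exp_add)
    moreover have "sqrt (pi / l) / d = sqrt (2 * pi)"
      using l by (simp add: d_def real_sqrt_mult real_sqrt_divide)
    then have "complex_of_real (sqrt (2 * pi)) = of_real (sqrt (pi / l)) * of_real (inverse d)"
      by (simp only: of_real_mult[symmetric] divide_inverse)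
    ultimately show ?thesis
      using d(1) by (simp only: K_def abs_of_pos scaleR_conv_of_real mult_ac)
  qed
  with 1 show ?thesis
    using lborel_has_bochner_integral_real_affine_iff[of d ?f "of_real (sqrt (pi / l)) * exp (of_real l * c\<^sup>2 / 4)" m] d(1)
    by simp
qed

section \<open>Gaussians on the complex plane and on finite products of it\<close>

lemma (in pair_sigma_finite) has_bochner_integral_pair_mult:
  fixes f g :: "_ \<Rightarrow> 'c::{real_normed_field, banach, second_countable_topology}"
  assumes f: "has_bochner_integral M1 f a" and g: "has_bochner_integral M2 g b"
  shows "has_bochner_integral (M1 \<Otimes>\<^sub>M M2) (\<lambda>(x, y). f x * g y) (a * b)"
proof -
  have f': "integrable M1 f" "integral\<^sup>L M1 f = a" and g': "integrable M2 g" "integral\<^sup>L M2 g = b"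
    using f g by (auto simp: has_bochner_integral_iff)
  note [measurable] = borel_measurable_integrable[OF f'(1)] borel_measurable_integrable[OF g'(1)]
  have int: "integrable (M1 \<Otimes>\<^sub>M M2) (\<lambda>(x, y). f x * g y)"
  proof (rule Fubini_integrable)
    show "integrable M1 (\<lambda>x. \<integral>y. norm (case (x, y) of (x, y) \<Rightarrow> f x * g y) \<partial>M2)"
      using f'(1) by (simp add: norm_mult)
    show "AE x in M1. integrable M2 (\<lambda>y. case (x, y) of (x, y) \<Rightarrow> f x * g y)"
      using g'(1) by simp
  qed simp
  have "integral\<^sup>L (M1 \<Otimes>\<^sub>M M2) (\<lambda>(x, y). f x * g y) = (\<integral>x. (\<integral>y. f x * g y \<partial>M2) \<partial>M1)"
    using integral_fst[OF int] by simp
  also have "\<dots> = a * b" using f' g' by simp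
  finally show ?thesis using int by (simp add: has_bochner_integral_iff)
qed

lemma measurable_Complex [measurable]:
  assumes [measurable]: "f \<in> borel_measurable M" "g \<in> borel_measurable M"
  shows "(\<lambda>x. Complex (f x) (g x)) \<in> borel_measurable M"
  unfolding Complex_eq by measurable

text \<open>The imaginary part comes first so that iterated integration takes the real part, the
  variable of Cauchy's integral, innermost.\<close>

lemma lborel_complex_eq:
  "(lborel :: complex measure) = distr (lborel \<Otimes>\<^sub>M lborel) borel (\<lambda>(y, x). Complex x y)"
proof (rule lborel_eqI)
  fix l u :: complex assume le: "\<And>b. b \<in> Basis \<Longrightarrow> l \<bullet> b \<le> u \<bullet> b"
  have le': "Re l \<le> Re u" "Im l \<le> Im u"
    using le[of 1] le[of \<i>] by (auto simp: Basis_complex_def)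
  have "(\<lambda>(y, x). Complex x y) -` box l u \<inter> space (lborel \<Otimes>\<^sub>M lborel) = {Im l<..<Im u} \<times> {Re l<..<Re u}"
    by (auto simp: box_def Basis_complex_def space_pair_measure)
  then have "emeasure (distr (lborel \<Otimes>\<^sub>M lborel) borel (\<lambda>(y, x). Complex x y)) (box l u)
      = emeasure (lborel \<Otimes>\<^sub>M lborel) ({Im l<..<Im u} \<times> {Re l<..<Re u})"
    by (subst emeasure_distr) auto
  also have "\<dots> = (Im u - Im l) * (Re u - Re l)"
    using le' by (subst lborel.emeasure_pair_measure_Times) (auto simp: ennreal_mult)
  also have "\<dots> = (\<Prod>b\<in>Basis. (u - l) \<bullet> b)"
    by (simp add: Basis_complex_def mult.commute)
  finally show "emeasure (distr (lborel \<Otimes>\<^sub>M lborel) borel (\<lambda>(y, x). Complex x y)) (box l u) = (\<Prod>b\<in>Basis. (u - l) \<bullet> b)" .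
qed simp

text \<open>In w = x + i y the exponent separates into two real Gaussians with linear coefficients z
  + cnj u and i (cnj u - z); their squares add up to 4 z cnj u.\<close>

lemma gaussian_complex_plane:
  fixes l :: real and z u :: complex
  assumes l: "l > 0"
  shows "has_bochner_integral lborel (\<lambda>w. exp (- (of_real l * (of_real ((cmod w)\<^sup>2) - z * cnj w - w * cnj u))))
    (of_real (pi / l) * exp (of_real l * z * cnj u))"
proof -
  let ?c = "z + cnj u" and ?d = "\<i> * (cnj u - z)"
  let ?g = "\<lambda>c x. exp (- of_real (l * x\<^sup>2) + of_real l * c * of_real x) :: complex"
  have 1: "has_bochner_integral (lborel \<Otimes>\<^sub>M lborel) (\<lambda>(y, x). ?g ?d y * ?g ?c x)
     ((of_real (sqrt (pi / l)) * exp (of_real l * ?d\<^sup>2 / 4)) * (of_real (sqrt (pi / l)) * exp (of_real l * ?c\<^sup>2 / 4)))"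
    by (intro lborel_pair.has_bochner_integral_pair_mult gaussian_complex_linear l)
  have v: "(of_real (sqrt (pi / l)) * exp (of_real l * ?d\<^sup>2 / 4)) * (of_real (sqrt (pi / l)) * exp (of_real l * ?c\<^sup>2 / 4))
     = of_real (pi / l) * exp (of_real l * z * cnj u)"
  proof -
    have "of_real l * ?d\<^sup>2 / 4 + of_real l * ?c\<^sup>2 / 4 = of_real l * z * cnj u"
      by (simp add: power_mult_distrib) (simp add: power2_eq_square field_simps)
    then have "exp (of_real l * ?d\<^sup>2 / 4) * exp (of_real l * ?c\<^sup>2 / 4) = exp (of_real l * z * cnj u)"
      by (simp only: exp_add[symmetric])
    moreover have "complex_of_real (sqrt (pi / l)) * of_real (sqrt (pi / l)) = of_real (pi / l)"
      using l by (simp only: of_real_mult[symmetric]) simp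
    moreover have "(a * b) * (a * c) = (a * a) * (b * c)" for a b c :: complex by (simp only: mult_ac)
    ultimately show ?thesis by (simp only:)
  qed
  have g: "?g ?d y * ?g ?c x = exp (- (of_real l * (of_real ((cmod (Complex x y))\<^sup>2) - z * cnj (Complex x y) - Complex x y * cnj u)))" for x y
  proof -
    have "(- of_real (l * y\<^sup>2) + of_real l * ?d * of_real y) + (- of_real (l * x\<^sup>2) + of_real l * ?c * of_real x)
     = - (of_real l * (of_real ((cmod (Complex x y))\<^sup>2) - z * cnj (Complex x y) - Complex x y * cnj u))"
      unfolding cmod_power2 by (simp add: complex_eq_iff algebra_simps)
    then show ?thesis by (simp only: exp_add[symmetric])
  qed
  show ?thesis
  proof (subst lborel_complex_eq, rule has_bochner_integral_distr)
    show "(\<lambda>w. exp (- (of_real l * (of_real ((cmod w)\<^sup>2) - z * cnj w - w * cnj u)))) \<in> borel_measurable borel"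
      by (intro borel_measurable_continuous_onI continuous_intros)
    show "(\<lambda>(y, x). Complex x y) \<in> lborel \<Otimes>\<^sub>M lborel \<rightarrow>\<^sub>M borel" by measurable
  qed (use 1 in \<open>simp only: v g split_def\<close>)
qed

lemma gaussian_complex_product:
  fixes l :: real and z u :: "'i \<Rightarrow> complex"
  assumes l: "l > 0" and I: "finite I"
  shows "has_bochner_integral (\<Pi>\<^sub>M i\<in>I. lborel)
    (\<lambda>w. exp (- (of_real l * (\<Sum>i\<in>I. of_real ((cmod (w i))\<^sup>2) - z i * cnj (w i) - w i * cnj (u i)))))
    (of_real ((pi / l) ^ card I) * exp (of_real l * (\<Sum>i\<in>I. z i * cnj (u i))))"
proof -
  interpret product_sigma_finite "\<lambda>_::'i. lborel :: complex measure" ..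
  let ?g = "\<lambda>i w. exp (- (of_real l * (of_real ((cmod w)\<^sup>2) - z i * cnj w - w * cnj (u i)))) :: complex"
  note g = gaussian_complex_plane[OF l]
  have int: "integrable lborel (?g i)" for i using g[of "z i" "u i"] by (simp add: has_bochner_integral_iff)
  have "has_bochner_integral (\<Pi>\<^sub>M i\<in>I. lborel) (\<lambda>w. \<Prod>i\<in>I. ?g i (w i)) (\<Prod>i\<in>I. integral\<^sup>L lborel (?g i))"
    unfolding has_bochner_integral_iff
    by (intro conjI product_integrable_prod product_integral_prod I int)
  also have "(\<lambda>w. \<Prod>i\<in>I. ?g i (w i)) = (\<lambda>w. exp (- (of_real l * (\<Sum>i\<in>I. of_real ((cmod (w i))\<^sup>2) - z i * cnj (w i) - w i * cnj (u i)))))"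
    by (simp only: exp_sum[OF I, symmetric] sum_negf sum_distrib_left)
  also have "(\<Prod>i\<in>I. integral\<^sup>L lborel (?g i)) = (\<Prod>i\<in>I. of_real (pi / l) * exp (of_real l * z i * cnj (u i)))"
    by (intro prod.cong refl has_bochner_integral_integral_eq g)
  also have "\<dots> = of_real ((pi / l) ^ card I) * exp (of_real l * (\<Sum>i\<in>I. z i * cnj (u i)))"
    by (simp only: prod.distrib prod_constant exp_sum[OF I, symmetric] sum_distrib_left of_real_power mult.assoc)
  finally show ?thesis .
qed

section \<open>Coordinates on the Siegel half-space\<close>

lemma measurable_vec_lambda [measurable (raw)]:
  fixes g :: "'n::finite \<Rightarrow> 'a \<Rightarrow> 'b::euclidean_space"
  assumes [measurable]: "\<And>i. g i \<in> borel_measurable M"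
  shows "(\<lambda>x. \<chi> i. g i x) \<in> M \<rightarrow>\<^sub>M (borel :: ('b ^ 'n) measure)"
proof (subst borel_measurable_euclidean_space, intro ballI)
  fix b :: "'b ^ 'n" assume "b \<in> Basis"
  then obtain i c where b: "b = axis i c" by (auto simp: Basis_vec_def)
  show "(\<lambda>x. (\<chi> i. g i x) \<bullet> b) \<in> borel_measurable M"
    unfolding b inner_axis by simp
qed

lemma lborel_vec_eq:
  "(lborel :: (complex ^ 'n) measure) = distr (\<Pi>\<^sub>M i\<in>UNIV. lborel) borel (\<lambda>f. \<chi> i. f i)"
proof (rule lborel_eqI)
  interpret product_sigma_finite "\<lambda>_::'n. lborel :: complex measure" ..
  fix l u :: "complex ^ 'n" assume le: "\<And>b. b \<in> Basis \<Longrightarrow> l \<bullet> b \<le> u \<bullet> b"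
  have le': "(l $ i) \<bullet> b \<le> (u $ i) \<bullet> b" if "b \<in> Basis" for i b
  proof -
    have "axis i b \<in> (Basis :: (complex ^ 'n) set)" using that by (auto simp: Basis_vec_def)
    from le[OF this] show ?thesis by (simp add: inner_axis)
  qed
  have [measurable]: "(\<lambda>f. \<chi> i. f i) \<in> (\<Pi>\<^sub>M i\<in>UNIV. (lborel :: complex measure)) \<rightarrow>\<^sub>M (borel :: (complex ^ 'n) measure)"
    by (rule measurable_vec_lambda) simp
  have "(\<lambda>f. \<chi> i. f i) -` box l u \<inter> space (\<Pi>\<^sub>M i\<in>UNIV. (lborel :: complex measure)) = Pi\<^sub>E UNIV (\<lambda>i. box (l $ i) (u $ i))"
    by (auto simp: box_def Basis_vec_def inner_axis space_PiM PiE_def)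
  then have "emeasure (distr (\<Pi>\<^sub>M i\<in>UNIV. lborel) borel (\<lambda>f. \<chi> i. f i)) (box l u)
      = emeasure (\<Pi>\<^sub>M i\<in>UNIV. (lborel :: complex measure)) (Pi\<^sub>E UNIV (\<lambda>i. box (l $ i) (u $ i)))"
    by (subst emeasure_distr) auto
  also have "\<dots> = (\<Prod>i\<in>UNIV. emeasure lborel (box (l $ i) (u $ i)))"
    by (rule emeasure_PiM) auto
  also have "\<dots> = (\<Prod>i\<in>UNIV. ennreal (\<Prod>b\<in>Basis. (u $ i - l $ i) \<bullet> b))"
    using le' by simp
  also have "\<dots> = ennreal (\<Prod>i\<in>UNIV. \<Prod>b\<in>Basis. (u $ i - l $ i) \<bullet> b)"
    using le' by (intro prod_ennreal prod_nonneg) (auto simp: inner_diff_left)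
  also have "(\<Prod>i\<in>UNIV. \<Prod>b\<in>Basis. (u $ i - l $ i) \<bullet> b) = (\<Prod>(i, b)\<in>UNIV \<times> Basis. (u $ i - l $ i) \<bullet> b)"
    by (rule prod.cartesian_product)
  also have "\<dots> = (\<Prod>b\<in>Basis. (u - l) \<bullet> b)"
  proof -
    have bij: "bij_betw (\<lambda>(i, b). axis i b) (UNIV \<times> Basis) (Basis :: (complex ^ 'n) set)"
      by (auto simp: bij_betw_def inj_on_def axis_eq_axis Basis_vec_def image_iff)
    have "(\<Prod>(i, b)\<in>UNIV \<times> Basis. (u $ i - l $ i) \<bullet> b) = (\<Prod>p\<in>UNIV \<times> Basis. (u - l) \<bullet> (case p of (i, b) \<Rightarrow> axis i b))"
      by (intro prod.cong refl) (auto simp: inner_axis)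
    also have "\<dots> = (\<Prod>b\<in>Basis. (u - l) \<bullet> b)"
      by (rule prod.reindex_bij_betw[OF bij])
    finally show ?thesis .
  qed
  finally show "emeasure (distr (\<Pi>\<^sub>M i\<in>UNIV. lborel) borel (\<lambda>f. \<chi> i. f i)) (box l u) = (\<Prod>b\<in>Basis. (u - l) \<bullet> b)" .
qed simp

text \<open>The order (f, y, x) is the order of integration, x innermost. With f ranging over the
  product on the indices other than \<open>last_idx\<close>, n = 1 is included: that product is then
  a one-point space of mass 1.\<close>

definition siegel_param :: "('n::{finite, linorder} \<Rightarrow> complex) \<times> real \<times> real \<Rightarrow> (complex, 'n) vec" where
  "siegel_param = (\<lambda>(f, y, x). \<chi> j. if j = last_idx
     then Complex x (y + (\<Sum>j\<in>UNIV - {last_idx}. (cmod (f j))\<^sup>2)) else f j)"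

lemma measurable_siegel_param [measurable]:
  "siegel_param \<in> ((\<Pi>\<^sub>M j\<in>UNIV - {last_idx :: 'n::{finite, linorder}}. lborel) \<Otimes>\<^sub>M (lborel \<Otimes>\<^sub>M lborel)) \<rightarrow>\<^sub>M borel"
  unfolding siegel_param_def split_def
proof (rule measurable_vec_lambda)
  fix i :: 'n
  let ?M = "(\<Pi>\<^sub>M j\<in>UNIV - {last_idx :: 'n}. (lborel :: complex measure)) \<Otimes>\<^sub>M (lborel \<Otimes>\<^sub>M lborel) :: (('n \<Rightarrow> complex) \<times> real \<times> real) measure"
  have [measurable]: "(\<lambda>p. fst p j) \<in> borel_measurable ?M" if "j \<noteq> last_idx" for j
  proof -
    have "(\<lambda>f. f j) \<in> (\<Pi>\<^sub>M j\<in>UNIV - {last_idx :: 'n}. (lborel :: complex measure)) \<rightarrow>\<^sub>M lborel"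
      using that by (intro measurable_component_singleton) simp
    from measurable_compose[OF measurable_fst this] show ?thesis by simp
  qed
  have [measurable]: "(\<lambda>p. \<Sum>j\<in>UNIV - {last_idx}. (cmod (fst p j))\<^sup>2) \<in> borel_measurable ?M"
    by (intro borel_measurable_sum) auto
  show "(\<lambda>p. if i = last_idx then Complex (snd (snd p)) (fst (snd p) + (\<Sum>j\<in>UNIV - {last_idx}. (cmod (fst p j))\<^sup>2))
        else fst p i) \<in> borel_measurable ?M"
    by (cases "i = last_idx") auto
qed

text \<open>For fixed f the map only translates the imaginary part of the last coordinate, by an
  amount depending on f alone; translation invariance on the line therefore gives Jacobian
  1.\<close>

lemma lborel_siegel_param:
  "(lborel :: ((complex, 'n::{finite, linorder}) vec) measure) =
    distr ((\<Pi>\<^sub>M j\<in>UNIV - {last_idx}. lborel) \<Otimes>\<^sub>M (lborel \<Otimes>\<^sub>M lborel)) borel siegel_param"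
proof (rule measure_eqI)
  interpret product_sigma_finite "\<lambda>_::'n. lborel :: complex measure" ..
  let ?I = "UNIV - {last_idx :: 'n}"
  let ?M = "\<Pi>\<^sub>M j\<in>?I. (lborel :: complex measure)"
  fix A :: "((complex, 'n) vec) set" assume "A \<in> sets lborel"
  then have A [measurable]: "A \<in> sets borel" by simp
  have [measurable]: "(\<lambda>f. \<chi> i. f i) \<in> (\<Pi>\<^sub>M i\<in>UNIV. (lborel :: complex measure)) \<rightarrow>\<^sub>M (borel :: ((complex, 'n) vec) measure)"
    by (rule measurable_vec_lambda) simp
  have ins: "insert last_idx ?I = (UNIV :: 'n set)" by auto
  have inner: "(\<integral>\<^sup>+w. indicator A (\<chi> i. (f(last_idx := w)) i) \<partial>lborel)
      = (\<integral>\<^sup>+p. indicator A (siegel_param (f, p)) \<partial>(lborel \<Otimes>\<^sub>M lborel))" for f :: "'n \<Rightarrow> complex"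
  proof -
    define N where "N = (\<Sum>j\<in>?I. (cmod (f j))\<^sup>2)"
    define g where "g w = (indicator A (\<chi> i. (f(last_idx := w)) i) :: ennreal)" for w
    have [measurable]: "(\<lambda>w. \<chi> i. (f(last_idx := w)) i) \<in> borel \<rightarrow>\<^sub>M borel"
    proof (rule measurable_vec_lambda)
      fix i show "(\<lambda>w. (f(last_idx := w)) i) \<in> borel \<rightarrow>\<^sub>M borel"
        by (cases "i = last_idx") auto
    qed
    have [measurable]: "g \<in> borel_measurable borel" unfolding g_def by measurable
    have "(\<integral>\<^sup>+w. g w \<partial>lborel) = (\<integral>\<^sup>+p. g (Complex (snd p) (fst p)) \<partial>(lborel \<Otimes>\<^sub>M lborel))"
      by (subst lborel_complex_eq, subst nn_integral_distr) (auto simp: split_def)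
    also have "\<dots> = (\<integral>\<^sup>+y. \<integral>\<^sup>+x. g (Complex x y) \<partial>lborel \<partial>lborel)"
      by (subst lborel.nn_integral_fst[symmetric]) auto
    \<comment> \<open>This translation by \<open>N\<close> is the shear.\<close>
    also have "\<dots> = (\<integral>\<^sup>+y. \<integral>\<^sup>+x. g (Complex x (N + 1 * y)) \<partial>lborel \<partial>lborel)"
      by (subst nn_integral_real_affine[where c = 1 and t = N]) auto
    also have "\<dots> = (\<integral>\<^sup>+p. g (Complex (snd p) (N + 1 * fst p)) \<partial>(lborel \<Otimes>\<^sub>M lborel))"
      by (subst lborel.nn_integral_fst[symmetric]) auto
    also have "\<dots> = (\<integral>\<^sup>+p. indicator A (siegel_param (f, p)) \<partial>(lborel \<Otimes>\<^sub>M lborel))"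
    proof (intro nn_integral_cong)
      fix p :: "real \<times> real"
      have "(\<chi> i. (f(last_idx := Complex (snd p) (N + 1 * fst p))) i) = siegel_param (f, p)"
        by (simp add: vec_eq_iff siegel_param_def N_def split_def)
      then show "g (Complex (snd p) (N + 1 * fst p)) = indicator A (siegel_param (f, p))"
        unfolding g_def by (rule arg_cong)
    qed
    finally show ?thesis by (simp add: g_def)
  qed
  have "emeasure lborel A = (\<integral>\<^sup>+w. indicator A w \<partial>lborel)" by simp
  also have "\<dots> = (\<integral>\<^sup>+f. indicator A (\<chi> i. f i) \<partial>(\<Pi>\<^sub>M i\<in>UNIV. lborel))"
    by (subst lborel_vec_eq, subst nn_integral_distr) auto
  also have "\<dots> = (\<integral>\<^sup>+f. \<integral>\<^sup>+w. indicator A (\<chi> i. (f(last_idx := w)) i) \<partial>lborel \<partial>?M)"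
    using product_nn_integral_insert[of ?I last_idx "\<lambda>f. indicator A (\<chi> i. f i)"] unfolding ins by simp
  also have "\<dots> = (\<integral>\<^sup>+f. \<integral>\<^sup>+p. indicator A (siegel_param (f, p)) \<partial>(lborel \<Otimes>\<^sub>M lborel) \<partial>?M)"
    unfolding inner ..
  also have "\<dots> = (\<integral>\<^sup>+q. indicator A (siegel_param q) \<partial>(?M \<Otimes>\<^sub>M (lborel \<Otimes>\<^sub>M lborel)))"
  proof -
    have "sigma_finite_measure (lborel \<Otimes>\<^sub>M lborel :: (real \<times> real) measure)"
      unfolding lborel_prod by (rule sigma_finite_lborel)
    then show ?thesis by (subst sigma_finite_measure.nn_integral_fst[symmetric]) auto
  qed
  also have "\<dots> = (\<integral>\<^sup>+w. indicator A w \<partial>distr (?M \<Otimes>\<^sub>M (lborel \<Otimes>\<^sub>M lborel)) borel siegel_param)"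
    by (subst nn_integral_distr) auto
  also have "\<dots> = emeasure (distr (?M \<Otimes>\<^sub>M (lborel \<Otimes>\<^sub>M lborel)) borel siegel_param) A"
    by simp
  finally show "emeasure lborel A = emeasure (distr (?M \<Otimes>\<^sub>M (lborel \<Otimes>\<^sub>M lborel)) borel siegel_param) A" .
qed simp

section \<open>The phase in the tangential variable and the integral of its powers\<close>

abbreviation tangential :: "('n::{finite, linorder} \<Rightarrow> complex) measure" where
  "tangential \<equiv> \<Pi>\<^sub>M j\<in>UNIV - {last_idx}. lborel"

lemma sigma_finite_tangential: "sigma_finite_measure (tangential :: ('n::{finite, linorder} \<Rightarrow> complex) measure)"
proof -
  interpret product_sigma_finite "\<lambda>_::'n. lborel :: complex measure" ..
  show ?thesis by (rule sigma_finite) simp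
qed

text \<open>The function \<open>E\<close> above: \<open>\<rho>(z,w) + \<rho>(w,u)\<close> at the boundary point \<open>w\<close> over \<open>f = w'\<close>.\<close>

definition siegel_phase ::
  "(complex, 'n::{finite, linorder}) vec \<Rightarrow> (complex, 'n) vec \<Rightarrow> ('n \<Rightarrow> complex) \<Rightarrow> complex" where
  "siegel_phase z u f = \<i> / 2 * (cnj (u $ last_idx) - z $ last_idx)
     + (\<Sum>j\<in>UNIV - {last_idx}. of_real ((cmod (f j))\<^sup>2) - z $ j * cnj (f j) - f j * cnj (u $ j))"

lemma measurable_siegel_phase [measurable]:
  fixes z u :: "(complex, 'n::{finite, linorder}) vec"
  shows "siegel_phase z u \<in> borel_measurable tangential"
proof -
  have [measurable]: "(\<lambda>f. f j) \<in> borel_measurable (tangential :: ('n \<Rightarrow> complex) measure)" if "j \<in> UNIV - {last_idx}" for j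
    using measurable_component_singleton[OF that, of "\<lambda>_. lborel :: complex measure"] by simp
  have [measurable]: "cnj \<in> borel_measurable borel"
    by (intro borel_measurable_continuous_onI continuous_intros)
  show ?thesis unfolding siegel_phase_def[abs_def]
    by (intro borel_measurable_add borel_measurable_const borel_measurable_sum) measurable
qed

text \<open>The real part is a function of z, plus the same function of u, plus the squared length
  of f. Through this mean, positivity and size estimates for a pair reduce to z = u.\<close>

lemma Re_siegel_phase:
  "Re (siegel_phase z u f) = (Re (siegel_phase z z f) + Re (siegel_phase u u f)) / 2"
proof -
  define a where "a v = Im (v $ last_idx) / 2 - (\<Sum>j\<in>UNIV - {last_idx}. Re (v $ j * cnj (f j)))" for v
  have *: "Re (siegel_phase v w f) = a v + a w + (\<Sum>j\<in>UNIV - {last_idx}. (cmod (f j))\<^sup>2)" for v w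
  proof -
    have "Re (f j * cnj (w $ j)) = Re (w $ j * cnj (f j))" for j by simp
    then show ?thesis
      unfolding siegel_phase_def a_def plus_complex.sel Re_sum minus_complex.sel sum_subtractf
      by (simp add: add_divide_distrib del: times_complex.sel(1))
  qed
  show ?thesis unfolding * by simp
qed

text \<open>Completing the square in each coordinate leaves - |z_j|^2, and these terms turn Im z_n
  into \<open>rho_diag z\<close>.\<close>

lemma siegel_phase_self:
  "siegel_phase z z f = of_real (rho_diag z + (\<Sum>j\<in>UNIV - {last_idx}. (cmod (z $ j - f j))\<^sup>2))"
proof -
  have "of_real ((cmod a)\<^sup>2) - b * cnj a - a * cnj b = of_real ((cmod (b - a))\<^sup>2) - complex_of_real ((cmod b)\<^sup>2)" for a b
    unfolding cmod_power2 by (simp add: complex_eq_iff power2_eq_square algebra_simps)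
  then have "siegel_phase z z f = \<i> / 2 * (cnj (z $ last_idx) - z $ last_idx)
      + (\<Sum>j\<in>UNIV - {last_idx}. of_real ((cmod (z $ j - f j))\<^sup>2) - of_real ((cmod (z $ j))\<^sup>2))"
    unfolding siegel_phase_def by (simp only:)
  also have "\<i> / 2 * (cnj (z $ last_idx) - z $ last_idx) = of_real (Im (z $ last_idx))"
    by (simp add: complex_eq_iff)
  finally show ?thesis
    unfolding rho_diag_def norm'_squared by (simp add: sum_subtractf)
qed

lemma Re_siegel_phase_self_pos:
  assumes "z \<in> siegel"
  shows "Re (siegel_phase z z f) > 0"
proof -
  have "rho_diag z > 0" using assms by (simp add: siegel_def rho_diag_def)
  moreover have "(\<Sum>j\<in>UNIV - {last_idx}. (cmod (z $ j - f j))\<^sup>2) \<ge> 0" by (intro sum_nonneg) simp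
  ultimately show ?thesis unfolding siegel_phase_self by simp
qed

lemma Re_siegel_phase_pos:
  assumes "z \<in> siegel" "u \<in> siegel"
  shows "Re (siegel_phase z u f) > 0"
  using Re_siegel_phase_self_pos[OF assms(1), of f] Re_siegel_phase_self_pos[OF assms(2), of f]
    Re_siegel_phase[of z u f] by simp

text \<open>The Gaussians contribute exp (l <z',u'>), and this inner product is exactly what the
  constant term of the phase lacks to become \<open>rho z u\<close>.\<close>

lemma gaussian_siegel_phase:
  fixes z u :: "(complex, 'n::{finite, linorder}) vec"
  assumes l: "l > 0"
  shows "has_bochner_integral tangential (\<lambda>f. exp (- (of_real l * siegel_phase z u f)))
    (of_real ((pi / l) ^ (CARD('n) - 1)) * exp (- (of_real l * rho z u)))"
proof -
  let ?I = "UNIV - {last_idx :: 'n}"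
  let ?e = "\<i> / 2 * (cnj (u $ last_idx) - z $ last_idx)"
  let ?S = "\<lambda>f :: 'n \<Rightarrow> complex. \<Sum>j\<in>?I. of_real ((cmod (f j))\<^sup>2) - z $ j * cnj (f j) - f j * cnj (u $ j)"
  have "has_bochner_integral tangential (\<lambda>f. exp (- (of_real l * ?e)) * exp (- (of_real l * ?S f)))
    (exp (- (of_real l * ?e)) * (of_real ((pi / l) ^ card ?I) * exp (of_real l * (\<Sum>j\<in>?I. z $ j * cnj (u $ j)))))"
    by (intro has_bochner_integral_mult_right gaussian_complex_product l) simp
  also have "(\<lambda>f. exp (- (of_real l * ?e)) * exp (- (of_real l * ?S f))) = (\<lambda>f. exp (- (of_real l * siegel_phase z u f)))"
    unfolding siegel_phase_def exp_add[symmetric] by (simp only: distrib_left minus_add_distrib)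
  also have "exp (- (of_real l * ?e)) * (of_real ((pi / l) ^ card ?I) * exp (of_real l * (\<Sum>j\<in>?I. z $ j * cnj (u $ j))))
     = of_real ((pi / l) ^ card ?I) * exp (- (of_real l * rho z u))"
  proof -
    have "- (of_real l * rho z u) = - (of_real l * ?e) + of_real l * (\<Sum>j\<in>?I. z $ j * cnj (u $ j))"
      unfolding rho_def hinner'_def right_diff_distrib by simp
    then show ?thesis by (simp only: exp_add mult_ac)
  qed
  also have "card ?I = CARD('n) - 1" by simp
  finally show ?thesis .
qed

lemma gaussian_siegel_phase_self:
  fixes z :: "(complex, 'n::{finite, linorder}) vec"
  assumes l: "l > 0"
  shows "has_bochner_integral tangential (\<lambda>f. exp (- (l * Re (siegel_phase z z f))))
    ((pi / l) ^ (CARD('n) - 1) * exp (- (l * rho_diag z)))"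
proof -
  have "has_bochner_integral tangential (\<lambda>f. Re (exp (- (of_real l * siegel_phase z z f))))
    (Re (of_real ((pi / l) ^ (CARD('n) - 1)) * exp (- (of_real l * rho z z))))"
    by (intro has_bochner_integral_bounded_linear[OF bounded_linear_Re] gaussian_siegel_phase l)
  then show ?thesis
    by (simp add: siegel_phase_self rho_self Re_exp del: of_real_power of_real_add)
qed

text \<open>The mixed exponential is dominated by the sum of the ones at z = u, for which the
  Gaussian integral of the modulus is known exactly.\<close>

lemma siegel_phase_laplace_integrable:
  fixes z u :: "(complex, 'n::{finite, linorder}) vec"
  assumes z: "z \<in> siegel" and u: "u \<in> siegel" and p: "p > real (CARD('n) - 1)"
  shows "integrable (lborel \<Otimes>\<^sub>M tangential) (\<lambda>(l, f). indicator {0<..} l *\<^sub>R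
    (of_real (l powr (p - 1)) * exp (- (of_real l * siegel_phase z u f))))"
proof -
  interpret T: sigma_finite_measure "tangential :: ('n \<Rightarrow> complex) measure" by (rule sigma_finite_tangential)
  interpret P: pair_sigma_finite lborel "tangential :: ('n \<Rightarrow> complex) measure" ..
  let ?m = "CARD('n) - 1"
  let ?k = "\<lambda>(v :: (complex, 'n) vec) l f. indicator {0<..} l * (l powr (p - 1) * exp (- (l * Re (siegel_phase v v f)))) :: real"
  have diag: "integrable (lborel \<Otimes>\<^sub>M tangential) (\<lambda>(l, f). ?k v l f)" if v: "v \<in> siegel" for v
  proof (rule P.integrable_pair_boundI)
    have "rho_diag v > 0" using v by (simp add: siegel_def rho_diag_def)
    then have "has_bochner_integral lborel (\<lambda>l. pi ^ ?m * (indicator {0<..} l * (l powr (p - real ?m - 1) * exp (- (l * rho_diag v)))))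
       (pi ^ ?m * (Gamma (p - real ?m) * rho_diag v powr (- (p - real ?m))))"
      using p by (intro has_bochner_integral_mult_right laplace_powr_real) auto
    then show "integrable lborel (\<lambda>l. pi ^ ?m * (indicator {0<..} l * (l powr (p - real ?m - 1) * exp (- (l * rho_diag v)))))"
      by (rule integrable.intros)
    fix l :: real
    show "(\<integral>\<^sup>+f. ennreal (norm (?k v l f)) \<partial>tangential) \<le> ennreal (pi ^ ?m * (indicator {0<..} l * (l powr (p - real ?m - 1) * exp (- (l * rho_diag v)))))"
    proof (cases "l > 0")
      case True
      have *: "has_bochner_integral tangential (\<lambda>f. l powr (p - 1) * exp (- (l * Re (siegel_phase v v f))))
          (l powr (p - 1) * ((pi / l) ^ ?m * exp (- (l * rho_diag v))))"
        by (intro has_bochner_integral_mult_right gaussian_siegel_phase_self True)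
      have "(\<integral>\<^sup>+f. ennreal (norm (?k v l f)) \<partial>tangential) = (\<integral>\<^sup>+f. ennreal (l powr (p - 1) * exp (- (l * Re (siegel_phase v v f)))) \<partial>tangential)"
        using True by (intro nn_integral_cong) simp
      also have "\<dots> = ennreal (l powr (p - 1) * ((pi / l) ^ ?m * exp (- (l * rho_diag v))))"
        using nn_integral_eq_integral[OF integrable.intros[OF *]]
        unfolding has_bochner_integral_integral_eq[OF *] by simp
      \<comment> \<open>The complex Gaussians cost l^(-(n-1)); the lower bound on p keeps the
        remaining power integrable at l = 0.\<close>
      also have "l powr (p - 1) * ((pi / l) ^ ?m * exp (- (l * rho_diag v))) = pi ^ ?m * (l powr (p - real ?m - 1) * exp (- (l * rho_diag v)))"
      proof -
        have "p - real ?m - 1 = (p - 1) - real ?m" by simp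
        then have "l powr (p - real ?m - 1) = l powr (p - 1) / l ^ ?m"
          using True by (simp only: powr_diff powr_realpow)
        then show ?thesis by (simp add: power_divide)
      qed
      finally show ?thesis using True by simp
    qed simp
  qed measurable
  have "integrable (lborel \<Otimes>\<^sub>M tangential) (\<lambda>x. (case x of (l, f) \<Rightarrow> ?k z l f) + (case x of (l, f) \<Rightarrow> ?k u l f))"
    by (intro Bochner_Integration.integrable_add diag z u)
  then show ?thesis
  proof (rule Bochner_Integration.integrable_bound)
    show "AE x in lborel \<Otimes>\<^sub>M tangential. norm (case x of (l, f) \<Rightarrow> indicator {0<..} l *\<^sub>R
        (of_real (l powr (p - 1)) * exp (- (of_real l * siegel_phase z u f))))
      \<le> norm ((case x of (l, f) \<Rightarrow> ?k z l f) + (case x of (l, f) \<Rightarrow> ?k u l f))"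
    proof (intro AE_I2)
      fix x :: "real \<times> ('n \<Rightarrow> complex)"
      obtain l f where x: "x = (l, f)" by (cases x)
      let ?e = "\<lambda>v w. exp (- (l * Re (siegel_phase v w f)))"
      \<comment> \<open>A mean is at least the smaller of its two terms, so the mixed exponential
        lies below one of the two diagonal ones.\<close>
      have avg: "a \<le> (a + b) / 2 \<or> b \<le> (a + b) / 2" for a b :: real by (cases "a \<le> b") auto
      have e: "?e z u \<le> ?e z z + ?e u u" if "l > 0"
      proof -
        have "Re (siegel_phase z z f) \<le> Re (siegel_phase z u f) \<or> Re (siegel_phase u u f) \<le> Re (siegel_phase z u f)"
          unfolding Re_siegel_phase[of z u f] by (rule avg)
        then have "?e z u \<le> ?e z z \<or> ?e z u \<le> ?e u u"
          using that by (simp only: exp_le_cancel_iff neg_le_iff_le mult_le_cancel_left_pos)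
        moreover have "?e z z > 0" "?e u u > 0" by simp_all
        ultimately show ?thesis by linarith
      qed
      have "norm (indicator {0<..} l *\<^sub>R (of_real (l powr (p - 1)) * exp (- (of_real l * siegel_phase z u f))))
          = indicator {0<..} l * (l powr (p - 1) * ?e z u)"
        by (simp add: norm_mult)
      also have "\<dots> \<le> indicator {0<..} l * (l powr (p - 1) * (?e z z + ?e u u))"
      proof (cases "l > 0")
        case True
        then show ?thesis using e[OF True] by (intro mult_left_mono) auto
      qed simp
      also have "\<dots> = ?k z l f + ?k u l f" by (simp only: distrib_left)
      also have "\<dots> \<le> norm (?k z l f + ?k u l f)" by (simp only: real_norm_def abs_ge_self)
      finally show "norm (case x of (l, f) \<Rightarrow> indicator {0<..} l *\<^sub>R
          (of_real (l powr (p - 1)) * exp (- (of_real l * siegel_phase z u f))))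
        \<le> norm ((case x of (l, f) \<Rightarrow> ?k z l f) + (case x of (l, f) \<Rightarrow> ?k u l f))"
        unfolding x prod.case .
    qed
  qed measurable
qed

text \<open>After the Gaussian integration the integral over l is again of Laplace type, now at
  \<open>rho z u\<close> and with exponent lowered by n - 1; this creates the power of
  \<open>rho z u\<close> in the final formula.\<close>

lemma siegel_phase_powr_integral:
  fixes z u :: "(complex, 'n::{finite, linorder}) vec"
  assumes z: "z \<in> siegel" and u: "u \<in> siegel" and p: "p > real (CARD('n) - 1)"
  defines "m \<equiv> CARD('n) - 1"
  shows "has_bochner_integral tangential (\<lambda>f. siegel_phase z u f powr (- of_real p))
    (of_real (pi ^ m * Gamma (p - real m) / Gamma p) * rho z u powr (- of_real (p - real m)))"
proof -
  interpret T: sigma_finite_measure "tangential :: ('n \<Rightarrow> complex) measure" by (rule sigma_finite_tangential)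
  interpret P: pair_sigma_finite "tangential :: ('n \<Rightarrow> complex) measure" lborel ..
  have p0: "p > 0" using p of_nat_0_le_iff[of "CARD('n) - 1"] by linarith
  have pm: "p - real m > 0" using p by (simp add: m_def)
  let ?g = "\<lambda>f l. indicator {0<..} l *\<^sub>R (of_real (l powr (p - 1)) * exp (- (of_real l * siegel_phase z u f)))"
  have "has_bochner_integral tangential (\<lambda>f. of_real (Gamma p) * siegel_phase z u f powr (- of_real p))
     (of_real (pi ^ m) * (of_real (Gamma (p - real m)) * rho z u powr (- of_real (p - real m))))"
  proof (rule P.has_bochner_integral_swap)
    show "integrable (tangential \<Otimes>\<^sub>M lborel) (\<lambda>(f, l). ?g f l)"
      using siegel_phase_laplace_integrable[OF z u p] P.integrable_product_swap_iff[of "\<lambda>(f, l). ?g f l"]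
      by (simp add: split_def)
    show "has_bochner_integral lborel (?g f) (of_real (Gamma p) * siegel_phase z u f powr (- of_real p))" for f
      by (intro laplace_powr p0 Re_siegel_phase_pos z u)
    show "has_bochner_integral lborel (\<lambda>l. of_real (pi ^ m) * (indicator {0<..} l *\<^sub>R (of_real (l powr (p - real m - 1)) * exp (- (of_real l * rho z u)))))
      (of_real (pi ^ m) * (of_real (Gamma (p - real m)) * rho z u powr (- of_real (p - real m))))"
      by (intro has_bochner_integral_mult_right laplace_powr pm Re_rho_pos z u)
    show "has_bochner_integral tangential (\<lambda>f. ?g f l)
      (of_real (pi ^ m) * (indicator {0<..} l *\<^sub>R (of_real (l powr (p - real m - 1)) * exp (- (of_real l * rho z u)))))" for l
    proof (cases "l > 0")
      case True
      have *: "has_bochner_integral tangential (\<lambda>f. of_real (l powr (p - 1)) * exp (- (of_real l * siegel_phase z u f)))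
        (of_real (l powr (p - 1)) * (of_real ((pi / l) ^ m) * exp (- (of_real l * rho z u))))"
        unfolding m_def by (intro has_bochner_integral_mult_right gaussian_siegel_phase True)
      have "l powr (p - 1) * (pi / l) ^ m = pi ^ m * l powr (p - real m - 1)"
      proof -
        have "p - real m - 1 = (p - 1) - real m" by simp
        then have "l powr (p - real m - 1) = l powr (p - 1) / l ^ m"
          using True by (simp only: powr_diff powr_realpow)
        then show ?thesis by (simp add: power_divide)
      qed
      then have e: "of_real (l powr (p - 1)) * (of_real ((pi / l) ^ m) * w) = of_real (pi ^ m) * (of_real (l powr (p - real m - 1)) * w)" for w :: complex
        by (simp only: mult.assoc[symmetric] of_real_mult[symmetric])
      show ?thesis using *[unfolded e] True by simp
    qed (simp add: has_bochner_integral_zero)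
  qed
  then have "has_bochner_integral tangential (\<lambda>f. siegel_phase z u f powr (- of_real p))
     (of_real (pi ^ m) * (of_real (Gamma (p - real m)) * rho z u powr (- of_real (p - real m))) / of_real (Gamma p))"
    by (rule has_bochner_integral_cmult_cancel) (use Gamma_real_pos[OF p0] in \<open>simp only: of_real_eq_0_iff; linarith\<close>)
  then show ?thesis by (simp only: of_real_mult of_real_divide mult.assoc times_divide_eq_right times_divide_eq_left)
qed

section \<open>Hermitian symmetry and \<open>rho\<close> in the shear coordinates\<close>

lemma cnj_rho: "cnj (rho z w) = rho w z"
  by (simp add: rho_def hinner'_def mult.commute right_diff_distrib)

text \<open>The real part of the last coordinate enters only through the factor i/2 in
  \<open>rho\<close>; the resulting x / 2 is later undone by a change of variable.\<close>

lemma rho_siegel_param_right: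
  "rho z (siegel_param (f, y, x)) = rho z (siegel_param (f, y, 0)) + \<i> * of_real (x / 2)"
  by (simp add: rho_def hinner'_def siegel_param_def complex_eq_iff)

lemma rho_siegel_param_left:
  "rho (siegel_param (f, y, x)) u = rho (siegel_param (f, y, 0)) u - \<i> * of_real (x / 2)"
  by (subst (1 2) cnj_rho[symmetric], subst rho_siegel_param_right) simp

text \<open>Each summand carries half of y + |f|^2, so the sum contains y with coefficient one, as
  the beta integral over y requires.\<close>

lemma rho_siegel_param_sum:
  "rho z (siegel_param (f, y, 0)) + rho (siegel_param (f, y, 0)) u = of_real y + siegel_phase z u f"
proof -
  define N where "N = (\<Sum>j\<in>UNIV - {last_idx}. (cmod (f j))\<^sup>2)"
  have a: "rho z (siegel_param (f, y, 0)) = of_real ((y + N) / 2) - \<i> / 2 * z $ last_idx - (\<Sum>j\<in>UNIV - {last_idx}. z $ j * cnj (f j))"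
    by (simp add: rho_def hinner'_def siegel_param_def complex_eq_iff N_def)
  have b: "rho (siegel_param (f, y, 0)) u = of_real ((y + N) / 2) + \<i> / 2 * cnj (u $ last_idx) - (\<Sum>j\<in>UNIV - {last_idx}. f j * cnj (u $ j))"
    by (simp add: rho_def hinner'_def siegel_param_def complex_eq_iff N_def)
  have c: "siegel_phase z u f = \<i> / 2 * cnj (u $ last_idx) - \<i> / 2 * z $ last_idx + of_real N
      - (\<Sum>j\<in>UNIV - {last_idx}. z $ j * cnj (f j)) - (\<Sum>j\<in>UNIV - {last_idx}. f j * cnj (u $ j))"
    by (simp add: siegel_phase_def sum_subtractf N_def right_diff_distrib)
  have half: "complex_of_real ((y + N) / 2) + of_real ((y + N) / 2) = of_real y + of_real N"
    by (simp only: of_real_add[symmetric]) simp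
  have "X - p - S + (X + v - R) = Y + (v - p + M - S - R)" if "X + X = Y + M" for X Y M p v S R :: complex
  proof -
    have "X - p - S + (X + v - R) = (X + X) + (v - p - S - R)" by simp
    then show ?thesis unfolding that by simp
  qed
  from this[OF half] show ?thesis unfolding a b c .
qed

text \<open>By Hermitian symmetry the sum formula at u = z is twice this real part.\<close>

lemma Re_rho_siegel_param: "Re (rho z (siegel_param (f, y, x))) = (y + Re (siegel_phase z z f)) / 2"
proof -
  let ?w = "siegel_param (f, y, 0)"
  have "Re (rho z ?w) + Re (rho ?w z) = y + Re (siegel_phase z z f)"
    using arg_cong[OF rho_siegel_param_sum[of z f y z], of Re] by simp
  moreover have "Re (rho ?w z) = Re (rho z ?w)"
    by (subst cnj_rho[symmetric]) simp
  ultimately show ?thesis by (subst rho_siegel_param_right) simp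
qed

lemma rho_diag_siegel_param [simp]: "rho_diag (siegel_param (f, y, x)) = y"
  unfolding rho_diag_def norm'_squared by (simp add: siegel_param_def)

lemma siegel_iff_rho_diag: "w \<in> siegel \<longleftrightarrow> rho_diag w > 0"
  by (simp add: siegel_def rho_diag_def)

lemma siegel_param_in_siegel [simp]: "siegel_param (f, y, x) \<in> siegel \<longleftrightarrow> y > 0"
  by (simp add: siegel_iff_rho_diag)

lemma measurable_rho [measurable]:
  fixes z :: "(complex, 'n::{finite, linorder}) vec"
  shows "(\<lambda>w. rho z w) \<in> borel_measurable borel" "(\<lambda>w. rho w z) \<in> borel_measurable borel"
    "(rho_diag :: (complex, 'n) vec \<Rightarrow> real) \<in> borel_measurable borel"
  unfolding rho_def hinner'_def rho_diag_def[abs_def] norm'_squared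
  by (intro borel_measurable_continuous_onI continuous_intros)+

lemma siegel_measurable [measurable]: "(siegel :: ((complex, 'n::{finite, linorder}) vec) set) \<in> sets borel"
proof -
  have "siegel = (rho_diag :: (complex, 'n) vec \<Rightarrow> real) -` {0<..}" by (auto simp: siegel_iff_rho_diag)
  moreover have "(rho_diag :: (complex, 'n) vec \<Rightarrow> real) -` {0<..} \<inter> space borel \<in> sets borel"
    by (rule measurable_sets[OF measurable_rho(3)]) simp
  ultimately show ?thesis by simp
qed

text \<open>Integrating x lowers the exponent to q - 1, integrating y lowers it by t + 1 more, and
  the power q - t - 2 of the phase is integrable over f when it exceeds n - 1, which is the
  hypothesis on q.\<close>

lemma siegel_weight_integrable:
  fixes z :: "(complex, 'n::{finite, linorder}) vec" and q t :: real
  assumes z: "z \<in> siegel" and t: "t > -1" and q: "q - t > real CARD('n) + 1"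
  shows "integrable (tangential \<Otimes>\<^sub>M (lborel \<Otimes>\<^sub>M lborel))
    (\<lambda>(f, y, x). indicator {0<..} y * (y powr t * cmod (rho z (siegel_param (f, y, x))) powr (- q)))"
proof -
  interpret T: sigma_finite_measure "tangential :: ('n \<Rightarrow> complex) measure" by (rule sigma_finite_tangential)
  interpret L: sigma_finite_measure "lborel \<Otimes>\<^sub>M lborel :: (real \<times> real) measure"
    unfolding lborel_prod by (rule sigma_finite_lborel)
  interpret P: pair_sigma_finite "tangential :: ('n \<Rightarrow> complex) measure" "lborel \<Otimes>\<^sub>M lborel :: (real \<times> real) measure" ..
  let ?h = "\<lambda>f (y, x). indicator {0<..} y * (y powr t * cmod (rho z (siegel_param (f, y, x))) powr (- q))"
  define Q where "Q f = Re (siegel_phase z z f)" for f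
  have Qpos: "Q f > 0" for f unfolding Q_def by (rule Re_siegel_phase_self_pos[OF z])
  have n: "real CARD('n) \<ge> 1" by simp
  have q1: "q > 1" "t + 1 < q - 1" "0 < t + 1" using q t n by linarith+
  \<comment> \<open>The leading 2 comes from the scaling x / 2, the bracket from the bound on the
    line integral, and the power of 1/2 from Re A = (y + Q f) / 2. \<open>k\<close> below is the
    beta constant of the integral over y.\<close>
  define c where "c = 2 * (2 powr q * (2 * Gamma (q - 1) / Gamma q)) * (1 / 2) powr (1 - q)"
  define k where "k = Gamma (t + 1) * Gamma (q - 1 - (t + 1)) / Gamma (q - 1)"
  have c: "c \<ge> 0" using q1 by (auto simp: c_def intro!: mult_nonneg_nonneg divide_nonneg_nonneg Gamma_real_nonneg)
  have x_int: "(\<integral>\<^sup>+x. ennreal (cmod (rho z (siegel_param (f, y, x))) powr (- q)) \<partial>lborel) \<le> ennreal (c * (y + Q f) powr (1 - q))"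
    if y: "y > 0" for f y
  proof -
    define A where "A = rho z (siegel_param (f, y, 0))"
    define g where "g x = cmod (A + \<i> * of_real x) powr (- q)" for x
    have A: "Re A = (y + Q f) / 2" unfolding A_def Re_rho_siegel_param Q_def ..
    have Apos: "Re A > 0" using y Qpos[of f] by (simp add: A)
    note g = cmod_halfplane_powr_integrable[OF Apos q1(1), folded g_def]
    have g2: "integrable lborel (\<lambda>x. g (0 + (1 / 2) * x))"
      by (rule lborel_integrable_real_affine[OF g(1)]) simp
    have "(\<integral>\<^sup>+x. ennreal (cmod (rho z (siegel_param (f, y, x))) powr (- q)) \<partial>lborel) = (\<integral>\<^sup>+x. ennreal (g (0 + (1 / 2) * x)) \<partial>lborel)"
    proof (intro nn_integral_cong)
      fix x :: real
      have "rho z (siegel_param (f, y, x)) = A + \<i> * of_real (x / 2)"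
        unfolding A_def by (rule rho_siegel_param_right)
      then show "ennreal (cmod (rho z (siegel_param (f, y, x))) powr (- q)) = ennreal (g (0 + (1 / 2) * x))"
        by (simp add: g_def)
    qed
    also have "\<dots> = ennreal (LINT x|lborel. g (0 + (1 / 2) * x))"
      by (rule nn_integral_eq_integral[OF g2]) (simp add: g_def)
    also have "(LINT x|lborel. g (0 + (1 / 2) * x)) = 2 * (LINT x|lborel. g x)"
      using lborel_integral_real_affine[of "1 / 2" g 0] by simp
    also have "2 * (LINT x|lborel. g x) \<le> 2 * (2 powr q * (2 * Gamma (q - 1) / Gamma q) * Re A powr (1 - q))"
      by (rule mult_left_mono[OF g(2)]) simp
    also have "Re A powr (1 - q) = (1 / 2) powr (1 - q) * (y + Q f) powr (1 - q)"
      using y Qpos[of f] unfolding A by (simp add: powr_mult[symmetric])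
    also have "2 * (2 powr q * (2 * Gamma (q - 1) / Gamma q) * ((1 / 2) powr (1 - q) * (y + Q f) powr (1 - q))) = c * (y + Q f) powr (1 - q)"
      unfolding c_def by (simp only: mult.assoc)
    finally show ?thesis by (simp add: ennreal_leI)
  qed
  have h_meas: "case_prod ?h \<in> borel_measurable (tangential \<Otimes>\<^sub>M (lborel \<Otimes>\<^sub>M lborel))"
    by measurable
  show ?thesis
  proof (rule P.integrable_pair_boundI[where N = "\<lambda>f. c * (k * Q f powr (t + 1 - (q - 1)))"])
    have p: "real (CARD('n) - 1) < q - 1 - (t + 1)" using q n by (simp add: of_nat_diff)
    have "integrable tangential (\<lambda>f. cmod (siegel_phase z z f powr (- of_real (q - 1 - (t + 1)))))"
      using siegel_phase_powr_integral[OF z z p] by (intro integrable_norm integrable.intros)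
    moreover have "cmod (siegel_phase z z f powr (- of_real (q - 1 - (t + 1)))) = Q f powr (t + 1 - (q - 1))" for f
    proof -
      have eq: "siegel_phase z z f = of_real (Q f)" by (simp add: Q_def siegel_phase_self)
      have e: "- complex_of_real (q - 1 - (t + 1)) = of_real (t + 1 - (q - 1))" by simp
      show ?thesis unfolding e cmod_powr_of_real eq using Qpos[of f] by simp
    qed
    ultimately show "integrable tangential (\<lambda>f. c * (k * Q f powr (t + 1 - (q - 1))))"
      by (intro integrable_mult_right) simp
    fix f :: "'n \<Rightarrow> complex"
    assume f: "f \<in> space tangential"
    have "(\<integral>\<^sup>+p. ennreal (norm (?h f p)) \<partial>(lborel \<Otimes>\<^sub>M lborel)) = (\<integral>\<^sup>+y. \<integral>\<^sup>+x. ennreal (?h f (y, x)) \<partial>lborel \<partial>lborel)"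
    proof -
      have [measurable]: "?h f \<in> borel_measurable (lborel \<Otimes>\<^sub>M lborel)"
        using measurable_compose[OF measurable_Pair1'[OF f] h_meas] by simp
      have "(\<integral>\<^sup>+p. ennreal (norm (?h f p)) \<partial>(lborel \<Otimes>\<^sub>M lborel)) = (\<integral>\<^sup>+p. ennreal (?h f p) \<partial>(lborel \<Otimes>\<^sub>M lborel))"
        by (intro nn_integral_cong) (simp add: split_def)
      also have "\<dots> = (\<integral>\<^sup>+y. \<integral>\<^sup>+x. ennreal (?h f (y, x)) \<partial>lborel \<partial>lborel)"
        by (rule lborel.nn_integral_fst[symmetric]) measurable
      finally show ?thesis .
    qed
    also have "\<dots> \<le> (\<integral>\<^sup>+y. ennreal (c * (indicator {0<..} y * (y powr (t + 1 - 1) * (y + Q f) powr (- (q - 1))))) \<partial>lborel)"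
    proof (intro nn_integral_mono)
      fix y :: real
      show "(\<integral>\<^sup>+x. ennreal (?h f (y, x)) \<partial>lborel) \<le> ennreal (c * (indicator {0<..} y * (y powr (t + 1 - 1) * (y + Q f) powr (- (q - 1)))))"
      proof (cases "y > 0")
        case True
        have "(\<integral>\<^sup>+x. ennreal (?h f (y, x)) \<partial>lborel) = ennreal (y powr t) * (\<integral>\<^sup>+x. ennreal (cmod (rho z (siegel_param (f, y, x))) powr (- q)) \<partial>lborel)"
        proof -
          have eq: "(\<lambda>x. rho z (siegel_param (f, y, x))) = (\<lambda>x. rho z (siegel_param (f, y, 0)) + \<i> * of_real (x / 2))"
            by (intro ext rho_siegel_param_right)
          have [measurable]: "(\<lambda>x. rho z (siegel_param (f, y, x))) \<in> borel_measurable borel"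
            by (subst eq) measurable
          show ?thesis
            using True by (subst nn_integral_cmult[symmetric]) (auto intro!: nn_integral_cong simp: ennreal_mult')
        qed
        also have "\<dots> \<le> ennreal (y powr t) * ennreal (c * (y + Q f) powr (1 - q))"
          by (intro mult_left_mono x_int True) simp
        also have "\<dots> = ennreal (c * (indicator {0<..} y * (y powr (t + 1 - 1) * (y + Q f) powr (- (q - 1)))))"
          using True c by (simp add: ennreal_mult'[symmetric] mult_ac)
        finally show ?thesis .
      qed simp
    qed
    also have "\<dots> = ennreal (c * (k * Q f powr (t + 1 - (q - 1))))"
    proof -
      have *: "has_bochner_integral lborel (\<lambda>y. c * (indicator {0<..} y * (y powr (t + 1 - 1) * (y + Q f) powr (- (q - 1)))))
          (c * (k * Q f powr (t + 1 - (q - 1))))"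
        unfolding k_def by (intro has_bochner_integral_mult_right beta_powr_real q1 Qpos)
      show ?thesis
        using nn_integral_eq_integral[OF integrable.intros[OF *]] c
        unfolding has_bochner_integral_integral_eq[OF *] by simp
    qed
    finally show "(\<integral>\<^sup>+p. ennreal (norm (?h f p)) \<partial>(lborel \<Otimes>\<^sub>M lborel)) \<le> ennreal (c * (k * Q f powr (t + 1 - (q - 1))))" .
  qed (rule h_meas)
qed

theorem mainTheorem2:
  fixes r s t :: real
  fixes z u :: "complex ^ 'n :: {finite, linorder}"
  assumes "r > 0" and "s > 0" and "t > -1"
  assumes "r + s - t > real CARD('n) + 1"
  assumes "z \<in> siegel" and "u \<in> siegel"
  shows "(LINT w:siegel|lborel.
            of_real (rho_diag w powr t) /
              (rho z w powr of_real r * rho w u powr of_real s)) =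
         of_real (C1 CARD('n) r s t) /
           rho z u powr of_real (r + s - t - real CARD('n) - 1)"
proof -
  interpret T: sigma_finite_measure "tangential :: ('n \<Rightarrow> complex) measure" by (rule sigma_finite_tangential)
  interpret L: sigma_finite_measure "lborel \<Otimes>\<^sub>M lborel :: (real \<times> real) measure"
    unfolding lborel_prod by (rule sigma_finite_lborel)
  interpret P: pair_sigma_finite "tangential :: ('n \<Rightarrow> complex) measure" "lborel \<Otimes>\<^sub>M lborel :: (real \<times> real) measure" ..
  note pos = assms(1,2) and z = assms(5) and u = assms(6)
  define m where "m = CARD('n) - 1"
  have n: "real CARD('n) \<ge> 1" by simp
  have m: "real CARD('n) = real m + 1" "CARD('n) = Suc m" by (simp_all add: m_def of_nat_diff)
  \<comment> \<open>The exponent of the phase after x has cost one and y has cost t + 1; the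
    tangential integral takes n - 1 more, which leaves the exponent of the claim.\<close>
  define p where "p = r + s - 1 - (t + 1)"
  have q: "r + s > 1" "t + 1 < r + s - 1" "0 < t + 1" using assms(3,4) n by linarith+
  have p: "p > real (CARD('n) - 1)" "p > 0" "p - real m = r + s - t - real CARD('n) - 1"
    using assms(4) n m by (simp_all add: p_def)
  \<comment> \<open>\<open>K\<close> is the constant of Cauchy's integral, \<open>k\<close> that of
    the beta integral over y.\<close>
  define K where "K = 2 * pi * Gamma (r + s - 1) / (Gamma r * Gamma s)"
  define k where "k = Gamma (t + 1) * Gamma p / Gamma (r + s - 1)"
  define A where "A f y = rho z (siegel_param (f, y, 0))" for f y
  define B where "B f y = rho (siegel_param (f, y, 0)) u" for f y
  define F where "F w = indicator siegel w *\<^sub>R (of_real (rho_diag w powr t) /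
      (rho z w powr of_real r * rho w u powr of_real s))" for w
  have F_meas [measurable]: "F \<in> borel_measurable borel"
    unfolding F_def[abs_def] by measurable
  have F_eq: "F (siegel_param (f, y, x)) =
      indicator {0<..} y *\<^sub>R (of_real (y powr t) * cauchy_kernel r s (A f y) (B f y) (x / 2))" for f y x
  proof -
    have a: "rho z (siegel_param (f, y, x)) = A f y + \<i> * of_real (x / 2)"
      unfolding A_def by (rule rho_siegel_param_right)
    have b: "rho (siegel_param (f, y, x)) u = B f y - \<i> * of_real (x / 2)"
      unfolding B_def by (rule rho_siegel_param_left)
    have c: "v / (a powr c * b powr d) = v * (a powr (- c) * b powr (- d))" for v a b c d :: complex
      by (simp add: powr_minus divide_inverse)
    have i: "indicator siegel (siegel_param (f, y, x)) = (indicator {0<..} y :: real)"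
      by (simp add: indicator_def)
    show ?thesis
      by (simp only: F_def i rho_diag_siegel_param c) (simp only: a b cauchy_kernel_def)
  qed
  have F_le: "norm (F (siegel_param (f, y, x))) \<le>
      indicator {0<..} y * (y powr t * cmod (rho z (siegel_param (f, y, x))) powr (- (r + s)))
      + indicator {0<..} y * (y powr t * cmod (rho u (siegel_param (f, y, x))) powr (- (r + s)))" for f y x
  proof (cases "y > 0")
    case True
    let ?w = "siegel_param (f, y, x)"
    have w: "?w \<in> siegel" using True by simp
    \<comment> \<open>Hermitian symmetry puts the integration point into the second slot, so the
      same diagonal majorant serves both z and u.\<close>
    have wu: "cmod (rho ?w u) = cmod (rho u ?w)"
      by (subst cnj_rho[symmetric]) (rule complex_mod_cnj)
    have "cmod (rho z ?w) > 0" "cmod (rho u ?w) > 0"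
      using Re_rho_pos[OF z w] Re_rho_pos[OF u w] by auto
    then have "cmod (rho z ?w) powr (- r) * cmod (rho u ?w) powr (- s)
        \<le> cmod (rho z ?w) powr (- (r + s)) + cmod (rho u ?w) powr (- (r + s))"
      using pos by (intro powr_mult_le_powr_sum) auto
    then have "y powr t * (cmod (rho z ?w) powr (- r) * cmod (rho u ?w) powr (- s))
        \<le> y powr t * (cmod (rho z ?w) powr (- (r + s)) + cmod (rho u ?w) powr (- (r + s)))"
      by (rule mult_left_mono) simp
    moreover have "norm (F ?w) = y powr t * (cmod (rho z ?w) powr (- r) * cmod (rho u ?w) powr (- s))"
      using True w by (simp add: F_def norm_divide norm_mult cmod_powr_of_real wu powr_minus divide_inverse norm_inverse)
    ultimately show ?thesis using True by (simp add: distrib_left)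
  qed (simp add: F_def)
  have int: "integrable (tangential \<Otimes>\<^sub>M (lborel \<Otimes>\<^sub>M lborel)) (\<lambda>x. F (siegel_param x))"
  proof (rule Bochner_Integration.integrable_bound)
    let ?W = "\<lambda>v (f, y, x). indicator {0<..} y * (y powr t * cmod (rho v (siegel_param (f, y, x))) powr (- (r + s)))"
    show "integrable (tangential \<Otimes>\<^sub>M (lborel \<Otimes>\<^sub>M lborel)) (\<lambda>x. ?W z x + ?W u x)"
      using assms(3,4) by (intro Bochner_Integration.integrable_add siegel_weight_integrable z u) auto
    show "AE x in tangential \<Otimes>\<^sub>M (lborel \<Otimes>\<^sub>M lborel). norm (F (siegel_param x)) \<le> norm (?W z x + ?W u x)"
    proof (intro AE_I2)
      fix x :: "('n \<Rightarrow> complex) \<times> real \<times> real"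
      obtain f y x' where x: "x = (f, y, x')" by (cases x)
      show "norm (F (siegel_param x)) \<le> norm (?W z x + ?W u x)"
        unfolding x prod.case real_norm_def by (rule order_trans[OF F_le abs_ge_self])
    qed
  qed measurable
  \<comment> \<open>Joint integrability yields an integrable slice only for almost every f, so this
    enters as a premise and the formula is later used almost everywhere.\<close>
  have inner: "(\<integral>w. F (siegel_param (f, w)) \<partial>(lborel \<Otimes>\<^sub>M lborel)) =
      of_real (2 * K * k) * siegel_phase z u f powr (- of_real p)"
    if int_f: "integrable (lborel \<Otimes>\<^sub>M lborel) (\<lambda>w. F (siegel_param (f, w)))" for f
  proof -
    let ?E = "siegel_phase z u f"
    have "(\<integral>w. F (siegel_param (f, w)) \<partial>(lborel \<Otimes>\<^sub>M lborel)) = (\<integral>y. (\<integral>x. F (siegel_param (f, y, x)) \<partial>lborel) \<partial>lborel)"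
      by (rule lborel_pair.integral_fst'[OF int_f, symmetric])
    also have "\<dots> = (\<integral>y. of_real (2 * K) * (indicator {0<..} y *\<^sub>R
        (of_real (y powr (t + 1 - 1)) * (of_real y + ?E) powr (- of_real (r + s - 1)))) \<partial>lborel)"
    proof (intro Bochner_Integration.integral_cong refl)
      fix y :: real
      show "(\<integral>x. F (siegel_param (f, y, x)) \<partial>lborel) = of_real (2 * K) * (indicator {0<..} y *\<^sub>R
        (of_real (y powr (t + 1 - 1)) * (of_real y + ?E) powr (- of_real (r + s - 1))))"
      proof (cases "y > 0")
        case True
        let ?w = "siegel_param (f, y, 0)"
        let ?k = "cauchy_kernel r s (A f y) (B f y)"
        have w: "?w \<in> siegel" using True by simp
        have AB: "A f y + B f y = of_real y + ?E"
          unfolding A_def B_def by (rule rho_siegel_param_sum)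
        have e: "complex_of_real (1 - r - s) = - of_real (r + s - 1)" by simp
        have "has_bochner_integral lborel ?k (of_real K * (A f y + B f y) powr of_real (1 - r - s))"
          using cauchy_beta_integral[OF pos q(1)] Re_rho_pos[OF z w] Re_rho_pos[OF w u]
          unfolding cauchy_beta_def K_def A_def B_def by blast
        then have k_int: "(\<integral>x. ?k x \<partial>lborel) = of_real K * (of_real y + ?E) powr (- of_real (r + s - 1))"
          unfolding AB e by (rule has_bochner_integral_integral_eq)
        \<comment> \<open>Rescaling x gives the second factor 2 of \<open>C1\<close>.\<close>
        have "(\<integral>x. ?k (x / 2) \<partial>lborel) = 2 * (\<integral>x. ?k x \<partial>lborel)"
          using lborel_integral_real_affine[of "1 / 2" ?k 0] by (simp add: scaleR_conv_of_real mult.commute)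
        moreover have "(\<integral>x. F (siegel_param (f, y, x)) \<partial>lborel) = of_real (y powr t) * (\<integral>x. ?k (x / 2) \<partial>lborel)"
          unfolding F_eq using True by simp
        ultimately show ?thesis unfolding k_int using True by simp
      qed (simp add: F_eq)
    qed
    also have "\<dots> = of_real (2 * K) * (of_real (Gamma (t + 1) * Gamma (r + s - 1 - (t + 1)) / Gamma (r + s - 1)) * ?E powr of_real (t + 1 - (r + s - 1)))"
      by (intro has_bochner_integral_integral_eq has_bochner_integral_mult_right beta_powr q Re_siegel_phase_pos z u)
    also have "of_real (t + 1 - (r + s - 1)) = - complex_of_real p" by (simp add: p_def)
    finally show ?thesis unfolding p_def[symmetric] k_def[symmetric] by (simp add: mult.assoc)
  qed
  have "(LINT w:siegel|lborel. of_real (rho_diag w powr t) / (rho z w powr of_real r * rho w u powr of_real s)) = integral\<^sup>L lborel F"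
    unfolding set_lebesgue_integral_def F_def ..
  also have "\<dots> = integral\<^sup>L (distr (tangential \<Otimes>\<^sub>M (lborel \<Otimes>\<^sub>M lborel)) borel siegel_param) F"
    by (subst lborel_siegel_param) (rule refl)
  also have "\<dots> = (\<integral>x. F (siegel_param x) \<partial>(tangential \<Otimes>\<^sub>M (lborel \<Otimes>\<^sub>M lborel)))"
    by (rule integral_distr) measurable
  also have "\<dots> = (\<integral>f. (\<integral>w. F (siegel_param (f, w)) \<partial>(lborel \<Otimes>\<^sub>M lborel)) \<partial>tangential)"
    by (rule P.integral_fst'[OF int, symmetric])
  also have "\<dots> = (\<integral>f. of_real (2 * K * k) * siegel_phase z u f powr (- of_real p) \<partial>tangential)"
  proof (rule integral_cong_AE)
    show "AE f in tangential. (\<integral>w. F (siegel_param (f, w)) \<partial>(lborel \<Otimes>\<^sub>M lborel)) = of_real (2 * K * k) * siegel_phase z u f powr (- of_real p)"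
      using P.AE_integrable_fst'[OF int] by eventually_elim (rule inner)
    show "(\<lambda>f. \<integral>w. F (siegel_param (f, w)) \<partial>(lborel \<Otimes>\<^sub>M lborel)) \<in> borel_measurable tangential"
      by (rule borel_measurable_integrable[OF P.integrable_fst'[OF int]])
  qed measurable
  also have "\<dots> = of_real (2 * K * k) * (of_real (pi ^ m * Gamma (p - real m) / Gamma p) * rho z u powr (- of_real (p - real m)))"
    unfolding m_def
    by (intro has_bochner_integral_integral_eq has_bochner_integral_mult_right siegel_phase_powr_integral z u p)
  also have "\<dots> = of_real (2 * K * k * (pi ^ m * Gamma (p - real m) / Gamma p)) * rho z u powr (- of_real (p - real m))"
    by (simp only: of_real_mult mult.assoc)
  \<comment> \<open>2 K supplies 4 pi, which with pi^m makes 4 pi^n; Gamma (r + s - 1) cancels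
    between \<open>K\<close> and \<open>k\<close>, and Gamma p between \<open>k\<close> and the
    tangential integral.\<close>
  also have "2 * K * k * (pi ^ m * Gamma (p - real m) / Gamma p) = C1 CARD('n) r s t"
  proof -
    have "Gamma p \<noteq> 0" using Gamma_real_pos[OF p(2)] by linarith
    moreover have "Gamma (r + s - 1) \<noteq> 0" using Gamma_real_pos[of "r + s - 1"] q(1) by linarith
    ultimately show ?thesis
      unfolding C1_def K_def k_def p(3) m(2) by (simp add: add.commute)
  qed
  also have "of_real (C1 CARD('n) r s t) * rho z u powr (- of_real (p - real m)) =
      of_real (C1 CARD('n) r s t) / rho z u powr of_real (r + s - t - real CARD('n) - 1)"
    unfolding p(3) powr_minus divide_inverse ..
  finally show ?thesis .
qed

end
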